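(* Let $k\ge 1$ and let $G$ be the group of $k\times k$ real matrices of nonzero determinant under matrix product, with identity matrix $I$. Let $(x_n)_{n\ge 1}$ be a sequence of independent random variables in $G$. Fix $r\in(0,1)$. Then $\hat{x}_n=x_1x_2\cdots x_n$ converges almost surely to a random matrix in $G$ as $n\to\infty$ if and only if the following three conditions all hold: (M1) $\sum_{n=1}^\infty P(\Vert x_n-I\Vert>r)<\infty$; (M2) $b_1b_2\cdots b_n$ converges in $G$ as $n\to\infty$, where $b_n=I+E\big[(x_n-I)1_{[\Vert x_n-I\Vert\le r]}\big]$; (M3) $\sum_{n=1}^\infty E\big(\Vert x_n-b_n\Vert^2 1_{[\Vert x_n-I\Vert\le r]}\big)<\infty$.
   Context: For a $k\times k$ real matrix $x=\{x_{ij}\}$, $\Vert x\Vert=\sqrt{\sum_{i,j}x_{ij}^2}$ is the Euclidean norm. $1_A$ denotes the indicator of an event $A$. Convergence in $G$ means that the limit exists and is an invertible matrix (i.e. the limit belongs to $G$). *)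

theory Defs
  imports "HOL-Probability.Probability"
begin

definition GL :: "(real ^ 'k ^ 'k) set" where
  "GL = {A. det A \<noteq> 0}"

text \<open>The left-to-right ordered product \<open>y 1 ** y 2 ** \<dots> ** y n\<close>; \<open>y 0\<close> is not used.\<close>

primrec ordered_prod :: "(nat \<Rightarrow> real ^ 'k ^ 'k) \<Rightarrow> nat \<Rightarrow> real ^ 'k ^ 'k" where
  "ordered_prod y 0 = mat 1"
| "ordered_prod y (Suc n) = ordered_prod y n ** y (Suc n)"

definition converges_in_GL :: "(nat \<Rightarrow> real ^ 'k ^ 'k) \<Rightarrow> bool" where
  "converges_in_GL s \<longleftrightarrow> (\<exists>L \<in> GL. s \<longlonglongrightarrow> L)"

text \<open>
  The norm of type \<^typ>\<open>real ^ 'k ^ 'k\<close>, an iterated Euclidean norm, is the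
  square root of the sum of the squares of all entries.
\<close>

lemma norm_matrix_eq:
  fixes A :: "real ^ 'k ^ 'k"
  shows "norm A = sqrt (\<Sum>i\<in>UNIV. \<Sum>j\<in>UNIV. (A $ i $ j)\<^sup>2)"
  by (simp add: norm_vec_def L2_set_def sum_nonneg)

text \<open>Only the deviation from the identity is truncated: \<open>I + E[(X - I) 1_{\<parallel>X - I\<parallel> \<le> r}]\<close>.\<close>

definition truncated_mean :: "'a measure \<Rightarrow> real \<Rightarrow> ('a \<Rightarrow> real ^ 'k ^ 'k) \<Rightarrow> real ^ 'k ^ 'k" where
  "truncated_mean M r X =
     mat 1 + (\<integral>\<omega>. indicator {\<omega> \<in> space M. norm (X \<omega> - mat 1) \<le> r} \<omega> *\<^sub>R (X \<omega> - mat 1) \<partial>M)"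

end

theory Submission
  imports Defs
begin

text \<open>
  Replacing every factor at distance more than \<open>r\<close> from the identity \<open>I\<close> by \<open>I\<close> gives independent
  factors \<open>y i\<close> with \<open>norm (y i - I) \<le> r < 1\<close>, whose means are the matrices \<open>b i\<close>. Under (M1) the
  first Borel--Cantelli lemma shows that almost surely only finitely many factors are replaced; if the
  product converges, its factors tend to \<open>I\<close>, so the same is true, and independence yields (M1)
  (\<open>summable_prob_compl_if_AE_eventually\<close>). Given (M1), condition (M3) says that the dispersions
  \<open>E (norm (y i - b i)\<^sup>2)\<close> are summable. It remains to compare the products \<open>P n\<close> of the \<open>y i\<close> with the
  products \<open>B n\<close> of the \<open>b i\<close>. Convergence in the group is used as a Cauchy condition: the products of
  the factors after a late time \<open>m\<close> stay near \<open>I\<close>.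

  The matrices \<open>Z n = P n ** matrix_inv (B n)\<close> form a martingale. While \<open>Z n\<close> and \<open>B n\<close> are near \<open>I\<close>, the
  mean square of its increment is at most a constant times the dispersion. Freezing \<open>Z\<close> when it
  leaves a ball gives an inequality of Kolmogorov's type (\<open>maximal_inequality\<close>). It proves two
  implications when the dispersions are summable: if \<open>B n\<close> converges, then so does \<open>P n\<close>
  (\<open>product_converges_if_means_converge\<close>); and if \<open>P n\<close> converges, then \<open>B n\<close>, which is deterministic and
  close to \<open>P n\<close> with positive probability, converges too (\<open>means_converge_if_product_converges\<close>).

  The remaining implication is that convergence of \<open>P n\<close> makes the dispersions summable
  (\<open>dispersions_summable_if_product_converges\<close>). Nothing is known about the means at this stage, so the
  product is compared with an independent copy \<open>P'\<close>. Passing from \<open>n\<close> to \<open>n + 1\<close>, the matrix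
  \<open>P n ** matrix_inv (P' n)\<close> acquires a factor \<open>z = y ** matrix_inv y'\<close> in the middle. Since \<open>z\<close> has the same
  distribution as its inverse, its drift \<open>E (z - I)\<close> is at most a constant times \<open>E (norm (z - I)\<^sup>2)\<close>.
  Near \<open>I\<close> the effect of the drift on \<open>norm (P n ** matrix_inv (P' n) - I)\<^sup>2\<close> is multiplied by a small distance and
  loses against the mean square of the increment. Frozen when \<open>P\<close> or the inverse of \<open>P'\<close> leaves a small ball, this
  bounded quantity therefore grows in mean by at least \<open>E (norm (z - I)\<^sup>2) / 2\<close> times the probability
  of not being frozen yet. That probability is bounded below, so the sum of \<open>E (norm (z - I)\<^sup>2)\<close> is
  finite, and it dominates the sum of the dispersions.
\<close>

section \<open>Matrices near the identity\<close>

lemma norm_matrix_power2: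
  fixes A :: "real ^ 'n ^ 'm"
  shows "(norm A)\<^sup>2 = (\<Sum>i\<in>UNIV. \<Sum>j\<in>UNIV. (A $ i $ j)\<^sup>2)"
  by (simp add: norm_vec_def L2_set_def sum_nonneg)

text \<open>
  Submultiplicativity of the Euclidean norm is the only fact about this norm that matters below;
  it comes from the Cauchy--Schwarz inequality for each entry of the product.
\<close>

lemma norm_matrix_mult_le:
  fixes A :: "real ^ 'n ^ 'm" and B :: "real ^ 'p ^ 'n"
  shows "norm (A ** B) \<le> norm A * norm B"
proof (rule power2_le_imp_le)
  have "(norm (A ** B))\<^sup>2 = (\<Sum>i\<in>UNIV. \<Sum>j\<in>UNIV. (\<Sum>k\<in>UNIV. A $ i $ k * B $ k $ j)\<^sup>2)"
    by (simp add: norm_matrix_power2 matrix_matrix_mult_def)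
  also have "\<dots> \<le> (\<Sum>i\<in>UNIV. \<Sum>j\<in>UNIV. (\<Sum>k\<in>UNIV. (A $ i $ k)\<^sup>2) * (\<Sum>k\<in>UNIV. (B $ k $ j)\<^sup>2))"
    by (intro sum_mono Cauchy_Schwarz_ineq_sum)
  also have "\<dots> = (\<Sum>i\<in>UNIV. \<Sum>k\<in>UNIV. (A $ i $ k)\<^sup>2) * (\<Sum>j\<in>UNIV. \<Sum>k\<in>UNIV. (B $ k $ j)\<^sup>2)"
    by (simp add: sum_product)
  also have "(\<Sum>j\<in>UNIV. \<Sum>k\<in>UNIV. (B $ k $ j)\<^sup>2) = (norm B)\<^sup>2"
    unfolding norm_matrix_power2 by (rule sum.swap)
  finally show "(norm (A ** B))\<^sup>2 \<le> (norm A * norm B)\<^sup>2"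
    by (simp add: norm_matrix_power2 power_mult_distrib)
qed simp

interpretation matrix_mult: bounded_bilinear "(**) :: real ^ 'n ^ 'm \<Rightarrow> real ^ 'p ^ 'n \<Rightarrow> real ^ 'p ^ 'm"
proof
  show "\<exists>K. \<forall>a b. norm ((a :: real ^ 'n ^ 'm) ** (b :: real ^ 'p ^ 'n)) \<le> norm a * norm b * K"
    using norm_matrix_mult_le by (metis mult.right_neutral)
qed (simp_all add: matrix_add_ldistrib matrix_matrix_mult_def vec_eq_iff sum.distrib
      sum_distrib_left algebra_simps)

text \<open>
  The Euclidean norm of \<open>mat 1\<close> is the square root of the dimension, so submultiplicativity alone
  would lose that factor at each multiplication. Writing \<open>A = I + (A - I)\<close> shows that multiplication
  by a matrix near the identity changes norms only by a factor near one.
\<close>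

lemma near_identity_mult_left:
  fixes A :: "real ^ 'k ^ 'k" and C :: "real ^ 'p ^ 'k"
  assumes "norm (A - mat 1) \<le> e"
  shows "norm (A ** C) \<le> (1 + e) * norm C" and "(1 - e) * norm C \<le> norm (A ** C)"
proof -
  have "A ** C = C + (A - mat 1) ** C"
    by (simp add: matrix_mult.diff_left)
  moreover have "norm ((A - mat 1) ** C) \<le> e * norm C"
    by (rule order_trans[OF norm_matrix_mult_le]) (simp add: assms mult_right_mono)
  ultimately show "norm (A ** C) \<le> (1 + e) * norm C" "(1 - e) * norm C \<le> norm (A ** C)"
    using norm_triangle_ineq[of C "(A - mat 1) ** C"]
      norm_triangle_ineq4[of "A ** C" "(A - mat 1) ** C"]
    by (auto simp: algebra_simps)
qed

lemma near_identity_mult_right: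
  fixes A :: "real ^ 'k ^ 'k" and C :: "real ^ 'k ^ 'p"
  assumes "norm (A - mat 1) \<le> e"
  shows "norm (C ** A) \<le> (1 + e) * norm C" and "(1 - e) * norm C \<le> norm (C ** A)"
proof -
  have "C ** A = C + C ** (A - mat 1)"
    by (simp add: matrix_mult.diff_right)
  moreover have "norm (C ** (A - mat 1)) \<le> e * norm C"
    using norm_matrix_mult_le[of C "A - mat 1"] mult_left_mono[OF assms norm_ge_zero[of C]]
    by (simp add: mult.commute)
  ultimately show "norm (C ** A) \<le> (1 + e) * norm C" "(1 - e) * norm C \<le> norm (C ** A)"
    using norm_triangle_ineq[of C "C ** (A - mat 1)"]
      norm_triangle_ineq4[of "C ** A" "C ** (A - mat 1)"]
    by (auto simp: algebra_simps)
qed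

lemma mat_1_in_GL [simp]: "mat 1 \<in> GL"
  by (simp add: GL_def)

lemma mult_in_GL_iff [simp]: "A ** B \<in> GL \<longleftrightarrow> A \<in> GL \<and> B \<in> GL"
  by (auto simp: GL_def det_mul)

lemma matrix_inv_mult:
  assumes "A \<in> GL"
  shows "A ** matrix_inv A = mat 1" "matrix_inv A ** A = mat 1"
proof -
  have "\<exists>A'. A ** A' = mat 1 \<and> A' ** A = mat 1"
    using assms invertible_det_nz[of A] by (auto simp: GL_def invertible_def)
  from someI_ex[OF this] show "A ** matrix_inv A = mat 1" "matrix_inv A ** A = mat 1"
    unfolding matrix_inv_def by auto
qed

lemma matrix_inv_cancel:
  assumes "A \<in> GL"
  shows "A ** (matrix_inv A ** C) = C" "matrix_inv A ** (A ** C) = C"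
    "D ** A ** matrix_inv A = D" "D ** matrix_inv A ** A = D"
  by (simp_all add: matrix_mul_assoc matrix_inv_mult[OF assms])
     (simp_all add: matrix_mul_assoc[symmetric] matrix_inv_mult[OF assms])

lemma matrix_inv_unique:
  fixes A B :: "real ^ 'k ^ 'k"
  assumes "A ** B = mat 1"
  shows "matrix_inv A = B"
proof -
  have "A \<in> GL"
    using assms by (metis mat_1_in_GL mult_in_GL_iff)
  then show ?thesis
    by (metis assms matrix_inv_cancel(2) matrix_mul_rid)
qed

lemma matrix_inv_matrix_mult:
  fixes A B :: "real ^ 'k ^ 'k"
  assumes "A \<in> GL" "B \<in> GL"
  shows "matrix_inv (A ** B) = matrix_inv B ** matrix_inv A"
  by (rule matrix_inv_unique)
     (simp add: matrix_mul_assoc matrix_inv_cancel[OF assms(2)] matrix_inv_mult[OF assms(1)])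

text \<open>
  A kernel vector is placed in every column of a matrix \<open>C\<close>; then \<open>A ** C = 0\<close>, and the lower bound
  on \<open>norm (A ** C)\<close> forces \<open>C = 0\<close>.
\<close>

lemma near_identity_in_GL:
  assumes "norm (A - mat 1) \<le> e" "e < 1"
  shows "A \<in> GL"
proof -
  have "B = 0" if "A *v B = 0" for B :: "real ^ 'a"
  proof -
    let ?C = "(\<chi> i j. B $ i) :: real ^ 'a ^ 'a"
    have "A ** ?C = 0"
      using that by (simp add: matrix_matrix_mult_def matrix_vector_mult_def vec_eq_iff)
    then have "(1 - e) * norm ?C \<le> 0"
      using near_identity_mult_left(2)[OF assms(1), of ?C] by simp
    then have "?C = 0"
      using assms(2) by (simp add: mult_le_0_iff)
    then show "B = 0"
      by (simp add: vec_eq_iff)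
  qed
  then have "\<exists>B. B ** A = mat 1"
    unfolding matrix_left_invertible_ker by blast
  then show ?thesis
    by (metis mat_1_in_GL mult_in_GL_iff)
qed

lemma norm_matrix_inv_near_identity:
  fixes A :: "real ^ 'k ^ 'k" and C :: "real ^ 'k ^ 'p"
  assumes "norm (A - mat 1) \<le> e" "e < 1"
  shows "norm (C ** matrix_inv A) \<le> norm C / (1 - e)"
    and "norm (matrix_inv A - mat 1) \<le> e / (1 - e)"
proof -
  note G = near_identity_in_GL[OF assms]
  have *: "norm (C ** matrix_inv A) \<le> norm C / (1 - e)" for C :: "real ^ 'k ^ 'r"
    using near_identity_mult_right(2)[OF assms(1), of "C ** matrix_inv A"] assms(2)
    by (simp add: matrix_inv_cancel[OF G] field_simps)
  from *[of C] show "norm (C ** matrix_inv A) \<le> norm C / (1 - e)" .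
  have "matrix_inv A - mat 1 = (mat 1 - A) ** matrix_inv A"
    by (simp add: matrix_mult.diff_left matrix_inv_mult[OF G])
  then have "norm (matrix_inv A - mat 1) \<le> norm (mat 1 - A) / (1 - e)"
    using *[of "mat 1 - A"] by simp
  also have "\<dots> \<le> e / (1 - e)"
    using assms by (intro divide_right_mono) (auto simp: norm_minus_commute)
  finally show "norm (matrix_inv A - mat 1) \<le> e / (1 - e)" .
qed

text \<open>
  Cramer's rule shows that inversion is continuous, and hence measurable, on the group.
\<close>

lemma matrix_inv_component_cramer:
  fixes A :: "real ^ 'k ^ 'k"
  assumes "A \<in> GL"
  shows "matrix_inv A $ i $ j =
    det (\<chi> a b. if b = i then axis j 1 $ a else A $ a $ b) / det A"
proof -
  have "A *v column j (matrix_inv A) = axis j 1"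
  proof -
    have "(A ** matrix_inv A) $ a $ j = mat 1 $ a $ j" for a
      by (simp add: matrix_inv_mult[OF assms])
    then show ?thesis
      by (simp add: vec_eq_iff matrix_matrix_mult_def matrix_vector_mult_def column_def
          mat_def axis_def)
  qed
  moreover have "det A \<noteq> 0"
    using assms by (simp add: GL_def)
  ultimately have "column j (matrix_inv A) =
      (\<chi> k. det (\<chi> a b. if b = k then axis j 1 $ a else A $ a $ b) / det A)"
    by (simp add: cramer)
  then show ?thesis
    by (simp add: vec_eq_iff column_def)
qed

lemma continuous_on_det [continuous_intros]:
  fixes f :: "'a::topological_space \<Rightarrow> real ^ 'k ^ 'k"
  assumes "continuous_on S f"
  shows "continuous_on S (\<lambda>x. det (f x))"
  unfolding det_def by (intro continuous_intros assms)

lemma continuous_on_matrix_inv: "continuous_on GL (matrix_inv :: real ^ 'k ^ 'k \<Rightarrow> _)"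
proof -
  have "continuous_on GL (\<lambda>A :: real ^ 'k ^ 'k. \<chi> i j.
      det (\<chi> a b. if b = i then axis j 1 $ a else A $ a $ b) / det A)"
  proof (intro continuous_on_vec_lambda continuous_on_divide continuous_on_det)
    show "continuous_on GL (\<lambda>A :: real ^ 'k ^ 'k. if b = i then axis j 1 $ a else A $ a $ b)"
      for i j a b
      by (cases "b = i") (auto intro!: continuous_intros)
  qed (auto simp: GL_def intro!: continuous_intros)
  then show ?thesis
    by (rule continuous_on_eq) (simp add: vec_eq_iff matrix_inv_component_cramer)
qed

lemma open_GL: "open (GL :: (real ^ 'k ^ 'k) set)"
  unfolding GL_def by (intro open_Collect_neq continuous_intros)

lemma GL_borel [measurable]: "(GL :: (real ^ 'k ^ 'k) set) \<in> sets borel"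
  using open_GL by (rule borel_open)

lemma borel_measurable_matrix_inv_restrict:
  "(\<lambda>A :: real ^ 'k ^ 'k. if A \<in> GL then matrix_inv A else mat 1) \<in> borel_measurable borel"
  by (rule borel_measurable_continuous_on_if) (auto intro: continuous_on_matrix_inv)

lemma borel_measurable_matrix_mult [measurable (raw)]:
  fixes f :: "'a \<Rightarrow> real ^ 'n ^ 'm" and g :: "'a \<Rightarrow> real ^ 'p ^ 'n"
  assumes "f \<in> borel_measurable M" "g \<in> borel_measurable M"
  shows "(\<lambda>x. f x ** g x) \<in> borel_measurable M"
  by (rule borel_measurable_continuous_Pair[OF assms])
     (intro matrix_mult.continuous_on continuous_intros)

section \<open>Convergence in the group\<close>

lemma ordered_prod_add:
  "ordered_prod y (m + n) = ordered_prod y m ** ordered_prod (\<lambda>i. y (m + i)) n"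
  by (induction n) (simp_all add: matrix_mul_assoc)

lemma ordered_prod_in_GL: "(\<And>i. 1 \<le> i \<Longrightarrow> i \<le> n \<Longrightarrow> y i \<in> GL) \<Longrightarrow> ordered_prod y n \<in> GL"
  by (induction n) auto

lemma ordered_prod_cong:
  "(\<And>i. 1 \<le> i \<Longrightarrow> i \<le> n \<Longrightarrow> y i = z i) \<Longrightarrow> ordered_prod y n = ordered_prod z n"
  by (induction n) auto

text \<open>
  Convergence in the group is equivalent to a Cauchy condition on the blocks
  \<open>y (m + 1) ** \<dots> ** y (m + n)\<close>: they approach the identity as \<open>m\<close> grows, uniformly in \<open>n\<close>. The block
  is \<open>Y m\<close> inverse times \<open>Y (m + n)\<close>, where \<open>Y\<close> is the sequence of partial products, and the inverses
  of the partial products are bounded because they converge too. This condition refers neither to the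
  limit nor to the initial factors, and random blocks inherit the hypotheses on the whole product.
\<close>

lemma converges_in_GL_ordered_prodD:
  assumes "converges_in_GL (ordered_prod y)" and GL: "\<And>i. 1 \<le> i \<Longrightarrow> y i \<in> GL" and "0 < e"
  shows "\<forall>\<^sub>F m in sequentially. \<forall>n. norm (ordered_prod (\<lambda>i. y (m + i)) n - mat 1) \<le> e"
proof -
  let ?Y = "ordered_prod y"
  obtain L where L: "L \<in> GL" "?Y \<longlonglongrightarrow> L"
    using assms(1) by (auto simp: converges_in_GL_def)
  have Y: "?Y n \<in> GL" for n
    by (intro ordered_prod_in_GL GL)
  have inv: "(\<lambda>n. matrix_inv (?Y n)) \<longlonglongrightarrow> matrix_inv L"
    by (rule continuous_on_tendsto_compose[OF continuous_on_matrix_inv L(2,1)]) (simp add: Y)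
  then obtain K where K: "0 < K" "\<And>n. norm (matrix_inv (?Y n)) \<le> K"
    using convergent_imp_Bseq[of "\<lambda>n. matrix_inv (?Y n)"] by (auto simp: convergent_def Bseq_def)
  have "Cauchy ?Y"
    using L(2) by (rule LIMSEQ_imp_Cauchy)
  then obtain m0 where m0: "\<And>m n. m \<ge> m0 \<Longrightarrow> n \<ge> m0 \<Longrightarrow> norm (?Y m - ?Y n) < e / K"
    unfolding Cauchy_iff using \<open>0 < e\<close> K(1) by (metis divide_pos_pos)
  show ?thesis
    unfolding eventually_sequentially
  proof (intro exI[of _ m0] allI impI)
    fix m n assume m: "m0 \<le> m"
    have "ordered_prod (\<lambda>i. y (m + i)) n - mat 1 = matrix_inv (?Y m) ** (?Y (m + n) - ?Y m)"
      by (simp add: ordered_prod_add matrix_mult.diff_right matrix_inv_cancel[OF Y] matrix_inv_mult[OF Y])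
    then have "norm (ordered_prod (\<lambda>i. y (m + i)) n - mat 1) \<le> K * norm (?Y (m + n) - ?Y m)"
      using norm_matrix_mult_le[of "matrix_inv (?Y m)" "?Y (m + n) - ?Y m"]
        mult_right_mono[OF K(2)[of m] norm_ge_zero[of "?Y (m + n) - ?Y m"]] by simp
    also have "\<dots> \<le> K * (e / K)"
      using m0[of "m + n" m] m K(1) by (intro mult_left_mono) auto
    finally show "norm (ordered_prod (\<lambda>i. y (m + i)) n - mat 1) \<le> e"
      using K(1) by simp
  qed
qed

text \<open>
  For the converse it is enough to have one suitable \<open>m\<close> for each \<open>e\<close>. Taking \<open>e = 1 / 2\<close> bounds the
  partial products, which turns the multiplicative condition into the additive Cauchy condition, and
  also keeps the limit, up to an invertible left factor, within \<open>1 / 2\<close> of the identity, so that it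
  is invertible.
\<close>

lemma converges_in_GL_ordered_prodI:
  assumes GL: "\<And>i. 1 \<le> i \<Longrightarrow> y i \<in> GL"
    and small: "\<And>e. 0 < e \<Longrightarrow> \<exists>m. \<forall>n. norm (ordered_prod (\<lambda>i. y (m + i)) n - mat 1) \<le> e"
  shows "converges_in_GL (ordered_prod y)"
proof -
  let ?Y = "ordered_prod y"
  have Y: "?Y n \<in> GL" for n
    by (intro ordered_prod_in_GL GL)
  obtain m0 where m0: "\<And>n. norm (ordered_prod (\<lambda>i. y (m0 + i)) n - mat 1) \<le> 1 / 2"
    using small[of "1/2"] by auto
  have "Bseq (\<lambda>n. ?Y (n + m0))"
  proof (rule BseqI')
    fix n
    show "norm (?Y (n + m0)) \<le> (1 + 1 / 2) * norm (?Y m0)"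
      using near_identity_mult_right(1)[OF m0, of "?Y m0" n] ordered_prod_add[of y m0 n]
      by (simp add: add.commute[of n])
  qed
  then obtain R where R: "0 < R" "\<And>n. norm (?Y n) \<le> R"
    using Bseq_offset[of ?Y m0] by (auto simp: Bseq_def)
  have "Cauchy ?Y"
  proof (rule metric_CauchyI)
    fix e :: real assume "0 < e"
    then obtain m where m: "\<And>n. norm (ordered_prod (\<lambda>i. y (m + i)) n - mat 1) \<le> e / (3 * R)"
      using small[of "e / (3 * R)"] R(1) by auto
    have *: "dist (?Y k) (?Y m) \<le> e / 3" if "m \<le> k" for k
    proof -
      have "?Y k - ?Y m = ?Y m ** (ordered_prod (\<lambda>i. y (m + i)) (k - m) - mat 1)"
        using ordered_prod_add[of y m "k - m"] that by (simp add: matrix_mult.diff_right)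
      then have "dist (?Y k) (?Y m) \<le> R * (e / (3 * R))"
        using norm_matrix_mult_le[of "?Y m" "ordered_prod (\<lambda>i. y (m + i)) (k - m) - mat 1"]
          mult_mono[OF R(2)[of m] m[of "k - m"]] R(1) by (simp add: dist_norm)
      then show ?thesis
        using R(1) by simp
    qed
    show "\<exists>M. \<forall>k\<ge>M. \<forall>n\<ge>M. dist (?Y k) (?Y n) < e"
    proof (intro exI[of _ m] allI impI)
      fix k n assume "m \<le> k" "m \<le> n"
      then show "dist (?Y k) (?Y n) < e"
        using *[of k] *[of n] dist_triangle2[of "?Y k" "?Y n" "?Y m"] \<open>0 < e\<close> by linarith
    qed
  qed
  then obtain L where L: "?Y \<longlonglongrightarrow> L"
    by (auto simp: Cauchy_convergent_iff convergent_def)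
  have "(\<lambda>n. matrix_inv (?Y m0) ** ?Y (n + m0) - mat 1) \<longlonglongrightarrow> matrix_inv (?Y m0) ** L - mat 1"
    by (intro tendsto_intros matrix_mult.tendsto LIMSEQ_ignore_initial_segment L)
  then have "norm (matrix_inv (?Y m0) ** L - mat 1) \<le> 1 / 2"
  proof (rule Lim_bounded[OF tendsto_norm, where M = 0])
    show "\<forall>n\<ge>0. norm (matrix_inv (?Y m0) ** ?Y (n + m0) - mat 1) \<le> 1 / 2"
      using m0 by (simp only: ordered_prod_add add.commute[of _ m0] matrix_inv_cancel[OF Y] simp_thms)
  qed
  then have "matrix_inv (?Y m0) ** L \<in> GL"
    by (rule near_identity_in_GL) simp
  then show ?thesis
    using L by (auto simp: converges_in_GL_def)
qed

lemma converges_in_GL_ordered_prod_transfer: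
  assumes "converges_in_GL (ordered_prod y)"
    and "\<And>i. 1 \<le> i \<Longrightarrow> y i \<in> GL" "\<And>i. 1 \<le> i \<Longrightarrow> z i \<in> GL"
    and eq: "\<forall>\<^sub>F i in sequentially. y i = z i"
  shows "converges_in_GL (ordered_prod z)"
proof (rule converges_in_GL_ordered_prodI)
  fix e :: real assume "0 < e"
  have "\<forall>\<^sub>F m in sequentially. \<forall>n. norm (ordered_prod (\<lambda>i. y (m + i)) n - mat 1) \<le> e"
    using assms(1,2) \<open>0 < e\<close> by (rule converges_in_GL_ordered_prodD)
  with eventually_all_ge_at_top[OF eq]
  have "\<forall>\<^sub>F m in sequentially. \<forall>n. norm (ordered_prod (\<lambda>i. z (m + i)) n - mat 1) \<le> e"
  proof eventually_elim
    case (elim m)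
    then have "ordered_prod (\<lambda>i. z (m + i)) n = ordered_prod (\<lambda>i. y (m + i)) n" for n
      by (intro ordered_prod_cong) auto
    then show ?case
      using elim by simp
  qed
  then show "\<exists>m. \<forall>n. norm (ordered_prod (\<lambda>i. z (m + i)) n - mat 1) \<le> e"
    by (auto simp: eventually_sequentially)
qed (use assms in auto)

section \<open>Stopped chains driven by independent inputs\<close>

text \<open>
  Fubini's theorem in the form in which independence is used: the second variable may be averaged
  over an independent sample point while the first is kept fixed.
\<close>

lemma (in prob_space) indep_var_integral:
  fixes h :: "'b \<times> 'b \<Rightarrow> real"
  assumes indep: "indep_var S X T Y" and h: "h \<in> borel_measurable (S \<Otimes>\<^sub>M T)"
    and int: "integrable M (\<lambda>\<omega>. h (X \<omega>, Y \<omega>))"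
  shows "integrable M (\<lambda>\<omega>. \<integral>\<omega>'. h (X \<omega>, Y \<omega>') \<partial>M)"
    and "(\<integral>\<omega>. h (X \<omega>, Y \<omega>) \<partial>M) = (\<integral>\<omega>. (\<integral>\<omega>'. h (X \<omega>, Y \<omega>') \<partial>M) \<partial>M)"
proof -
  note h [measurable]
  have X [measurable]: "X \<in> M \<rightarrow>\<^sub>M S" and Y [measurable]: "Y \<in> M \<rightarrow>\<^sub>M T"
    and D: "distr M S X \<Otimes>\<^sub>M distr M T Y = distr M (S \<Otimes>\<^sub>M T) (\<lambda>\<omega>. (X \<omega>, Y \<omega>))"
    using indep by (auto simp: indep_var_distribution_eq)
  interpret X: prob_space "distr M S X" by (rule prob_space_distr) fact
  interpret Y: prob_space "distr M T Y" by (rule prob_space_distr) fact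
  interpret XY: pair_sigma_finite "distr M S X" "distr M T Y" ..
  have int': "integrable (distr M S X \<Otimes>\<^sub>M distr M T Y) h"
    unfolding D using int by (subst integrable_distr_eq) auto
  have inner: "(\<integral>y. h (x, y) \<partial>distr M T Y) = (\<integral>\<omega>'. h (x, Y \<omega>') \<partial>M)" if "x \<in> space S" for x
    using that by (subst integral_distr) auto
  have "integrable (distr M S X) (\<lambda>x. \<integral>y. h (x, y) \<partial>distr M T Y)"
    using XY.integrable_fst'[OF int'] .
  then have "integrable M (\<lambda>\<omega>. \<integral>y. h (X \<omega>, y) \<partial>distr M T Y)"
    by (rule integrable_distr[OF X])
  also have "?this \<longleftrightarrow> integrable M (\<lambda>\<omega>. \<integral>\<omega>'. h (X \<omega>, Y \<omega>') \<partial>M)"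
    using measurable_space[OF X]
    by (intro Bochner_Integration.integrable_cong refl) (auto simp: inner)
  finally show "integrable M (\<lambda>\<omega>. \<integral>\<omega>'. h (X \<omega>, Y \<omega>') \<partial>M)" .
  have "(\<integral>\<omega>. h (X \<omega>, Y \<omega>) \<partial>M) = integral\<^sup>L (distr M S X \<Otimes>\<^sub>M distr M T Y) h"
    unfolding D by (subst integral_distr) auto
  also have "\<dots> = (\<integral>x. (\<integral>y. h (x, y) \<partial>distr M T Y) \<partial>distr M S X)"
    using XY.integral_fst'[OF int'] by simp
  also have "\<dots> = (\<integral>\<omega>. (\<integral>y. h (X \<omega>, y) \<partial>distr M T Y) \<partial>M)"
    by (subst integral_distr) auto
  also have "\<dots> = (\<integral>\<omega>. (\<integral>\<omega>'. h (X \<omega>, Y \<omega>') \<partial>M) \<partial>M)"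
    using measurable_space[OF X] by (intro Bochner_Integration.integral_cong) (auto simp: inner)
  finally show "(\<integral>\<omega>. h (X \<omega>, Y \<omega>) \<partial>M) = (\<integral>\<omega>. (\<integral>\<omega>'. h (X \<omega>, Y \<omega>') \<partial>M) \<partial>M)" .
qed

text \<open>
  The inputs are indexed from 1, to match \<^const>\<open>ordered_prod\<close>: the step \<open>F n\<close> consumes the input
  \<open>u (Suc n)\<close>.
\<close>

primrec chain :: "(nat \<Rightarrow> 's \<Rightarrow> 'x \<Rightarrow> 's) \<Rightarrow> 's \<Rightarrow> (nat \<Rightarrow> 'x) \<Rightarrow> nat \<Rightarrow> 's" where
  "chain F c u 0 = c"
| "chain F c u (Suc n) = F n (chain F c u n) (u (Suc n))"

definition stop_outside :: "'s set \<Rightarrow> (nat \<Rightarrow> 's \<Rightarrow> 'x \<Rightarrow> 's) \<Rightarrow> nat \<Rightarrow> 's \<Rightarrow> 'x \<Rightarrow> 's" where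
  "stop_outside A F n s x = (if s \<in> A then F n s x else s)"

lemma chain_cong: "(\<And>i. 1 \<le> i \<Longrightarrow> i \<le> n \<Longrightarrow> u i = v i) \<Longrightarrow> chain F c u n = chain F c v n"
  by (induction n) auto

text \<open>
  A stopped chain that is still inside \<open>A\<close> has never been stopped, so it agrees with the original
  chain and records that the original chain stayed inside \<open>A\<close>. Hence a bound on the stopped
  chain at one time controls the original chain at all earlier times.
\<close>

lemma chain_stop_outside_in:
  assumes "chain (stop_outside A F) c u n \<in> A" "j \<le> n"
  shows "chain F c u j \<in> A"
proof -
  have "chain (stop_outside A F) c u n \<in> A \<Longrightarrow>
      \<forall>j\<le>n. chain (stop_outside A F) c u j = chain F c u j \<and> chain F c u j \<in> A" for n
  proof (induction n)
    case (Suc n)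
    have "chain (stop_outside A F) c u n \<in> A"
      using Suc.prems by (auto simp: stop_outside_def[of A F n] split: if_splits)
    with Suc show ?case
      by (auto simp: le_Suc_eq stop_outside_def[of A F n])
  qed simp
  with assms show ?thesis by blast
qed

lemma chain_stop_outside_eq:
  "(\<And>j. j < n \<Longrightarrow> chain F c u j \<in> A) \<Longrightarrow> chain (stop_outside A F) c u n = chain F c u n"
  by (induction n) (auto simp: stop_outside_def)

lemma measurable_chain:
  assumes F: "\<And>n. (\<lambda>(s, x). F n s x) \<in> S \<Otimes>\<^sub>M N \<rightarrow>\<^sub>M S" and c: "c \<in> space S" and "{1..n} \<subseteq> I"
  shows "(\<lambda>u. chain F c u n) \<in> PiM I (\<lambda>_. N) \<rightarrow>\<^sub>M S"
  using \<open>{1..n} \<subseteq> I\<close>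
proof (induction n)
  case (Suc n)
  then have "{1..n} \<subseteq> I" "Suc n \<in> I"
    by auto
  with Suc.IH have "(\<lambda>u. (chain F c u n, u (Suc n))) \<in> PiM I (\<lambda>_. N) \<rightarrow>\<^sub>M S \<Otimes>\<^sub>M N"
    by (intro measurable_Pair measurable_component_singleton)
  from measurable_compose[OF this F[of n]] show ?case by simp
qed (simp add: c)

lemma (in prob_space) measurable_chain_inputs:
  assumes indep: "indep_vars (\<lambda>_. N) \<xi> {1..}"
    and F: "\<And>n. (\<lambda>(s, x). F n s x) \<in> S \<Otimes>\<^sub>M N \<rightarrow>\<^sub>M S" and c: "c \<in> space S"
  shows "(\<lambda>\<omega>. chain F c (\<lambda>i. \<xi> i \<omega>) n) \<in> M \<rightarrow>\<^sub>M S"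
proof -
  have "(\<lambda>\<omega>. \<lambda>i\<in>{1..n}. \<xi> i \<omega>) \<in> M \<rightarrow>\<^sub>M PiM {1..n} (\<lambda>_. N)"
    using indep by (intro measurable_restrict) (auto simp: indep_vars_def)
  from measurable_compose[OF this measurable_chain[OF F c order_refl]]
  have "(\<lambda>\<omega>. chain F c (\<lambda>i\<in>{1..n}. \<xi> i \<omega>) n) \<in> M \<rightarrow>\<^sub>M S" .
  also have "(\<lambda>\<omega>. chain F c (\<lambda>i\<in>{1..n}. \<xi> i \<omega>) n) = (\<lambda>\<omega>. chain F c (\<lambda>i. \<xi> i \<omega>) n)"
    by (intro ext chain_cong) simp
  finally show ?thesis .
qed

lemma (in prob_space) integral_chain_step:
  fixes h :: "'s \<times> 'x \<Rightarrow> real"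
  assumes indep: "indep_vars (\<lambda>_. N) \<xi> {1..}"
    and F: "\<And>n. (\<lambda>(s, x). F n s x) \<in> S \<Otimes>\<^sub>M N \<rightarrow>\<^sub>M S" and c: "c \<in> space S"
    and h: "h \<in> borel_measurable (S \<Otimes>\<^sub>M N)"
  fixes n :: nat
  defines "s \<equiv> \<lambda>\<omega>. chain F c (\<lambda>i. \<xi> i \<omega>) n"
  assumes int: "integrable M (\<lambda>\<omega>. h (s \<omega>, \<xi> (Suc n) \<omega>))"
  shows "integrable M (\<lambda>\<omega>. \<integral>\<omega>'. h (s \<omega>, \<xi> (Suc n) \<omega>') \<partial>M)"
    and "(\<integral>\<omega>. h (s \<omega>, \<xi> (Suc n) \<omega>) \<partial>M) = (\<integral>\<omega>. (\<integral>\<omega>'. h (s \<omega>, \<xi> (Suc n) \<omega>') \<partial>M) \<partial>M)"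
proof -
  have *: "indep_var (PiM {1..n} (\<lambda>_. N)) (\<lambda>\<omega>. \<lambda>i\<in>{1..n}. \<xi> i \<omega>)
      (PiM {Suc n} (\<lambda>_. N)) (\<lambda>\<omega>. \<lambda>i\<in>{Suc n}. \<xi> i \<omega>)"
    by (rule indep_var_restrict[OF indep]) auto
  note [measurable] = measurable_chain[OF F c order_refl, where n = n]
    measurable_component_singleton[of "Suc n" "{Suc n}" "\<lambda>_. N"] h
  have "(\<lambda>(u, v). h (chain F c u n, v (Suc n)))
      \<in> borel_measurable (PiM {1..n} (\<lambda>_. N) \<Otimes>\<^sub>M PiM {Suc n} (\<lambda>_. N))"
    by measurable
  moreover have "chain F c (\<lambda>i\<in>{1..n}. \<xi> i \<omega>) n = s \<omega>" for \<omega>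
    unfolding s_def by (rule chain_cong) simp
  ultimately show "integrable M (\<lambda>\<omega>. \<integral>\<omega>'. h (s \<omega>, \<xi> (Suc n) \<omega>') \<partial>M)"
    and "(\<integral>\<omega>. h (s \<omega>, \<xi> (Suc n) \<omega>) \<partial>M) = (\<integral>\<omega>. (\<integral>\<omega>'. h (s \<omega>, \<xi> (Suc n) \<omega>') \<partial>M) \<partial>M)"
    using indep_var_integral[OF *, of "\<lambda>(u, v). h (chain F c u n, v (Suc n))"] int by simp_all
qed

text \<open>
  A function \<open>\<Phi>\<close> is followed along a chain with independent inputs that is frozen when it leaves
  \<open>A\<close>. The last step may jump out of \<open>A\<close>, so \<open>\<Phi>\<close> is bounded by \<open>C\<close> both on \<open>A\<close> and after one step
  from \<open>A\<close>; this makes all expectations finite. Estimates for a single step from a fixed point of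
  \<open>A\<close> then add up to estimates of the expectation of \<open>\<Phi>\<close>. The upper estimate serves a maximal
  inequality; the lower estimate forces a series to converge because \<open>\<Phi>\<close> stays bounded.
\<close>

locale stopped_chain = prob_space M for M :: "'a measure" +
  fixes \<xi> :: "nat \<Rightarrow> 'a \<Rightarrow> 'x" and N :: "'x measure"
    and F :: "nat \<Rightarrow> 's::topological_space \<Rightarrow> 'x \<Rightarrow> 's" and A :: "'s set" and c :: 's
    and \<Phi> :: "'s \<Rightarrow> real" and C :: real
  assumes indep: "indep_vars (\<lambda>_. N) \<xi> {1..}"
    and F_measurable: "\<And>n. (\<lambda>(s, x). F n s x) \<in> borel \<Otimes>\<^sub>M N \<rightarrow>\<^sub>M borel"
    and A_measurable [measurable]: "A \<in> sets borel"
    and \<Phi>_measurable [measurable]: "\<Phi> \<in> borel_measurable borel"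
    and \<Phi>_nonneg: "\<And>s. 0 \<le> \<Phi> s"
    and start: "c \<in> A"
    and \<Phi>_bound: "\<And>s. s \<in> A \<Longrightarrow> \<Phi> s \<le> C"
    and \<Phi>_step_bound: "\<And>n s \<omega>. s \<in> A \<Longrightarrow> \<omega> \<in> space M \<Longrightarrow> \<Phi> (F n s (\<xi> (Suc n) \<omega>)) \<le> C"
begin

definition state :: "nat \<Rightarrow> 'a \<Rightarrow> 's" where
  "state n \<omega> = chain (stop_outside A F) c (\<lambda>i. \<xi> i \<omega>) n"

lemma \<xi>_measurable [measurable]: "\<xi> (Suc n) \<in> M \<rightarrow>\<^sub>M N"
  using indep by (auto simp: indep_vars_def)

lemma stop_measurable: "(\<lambda>(s, x). stop_outside A F n s x) \<in> borel \<Otimes>\<^sub>M N \<rightarrow>\<^sub>M borel"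
proof -
  have [measurable]: "(\<lambda>p. F n (fst p) (snd p)) \<in> borel \<Otimes>\<^sub>M N \<rightarrow>\<^sub>M borel"
    using F_measurable[of n] by (simp add: case_prod_beta')
  show ?thesis
    unfolding stop_outside_def case_prod_beta' by measurable
qed

lemma state_measurable [measurable]: "state n \<in> borel_measurable M"
  unfolding state_def[abs_def] by (intro measurable_chain_inputs[OF indep stop_measurable]) simp

lemma \<Phi>_state_bound: "\<omega> \<in> space M \<Longrightarrow> \<Phi> (state n \<omega>) \<le> C"
proof (induction n)
  case (Suc n)
  then show ?case
    using \<Phi>_step_bound by (auto simp: state_def stop_outside_def)
qed (simp add: state_def start \<Phi>_bound)

lemma integrable_\<Phi>_state [simp]: "integrable M (\<lambda>\<omega>. \<Phi> (state n \<omega>))"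
  by (rule integrable_const_bound[where B = C]) (auto simp: \<Phi>_nonneg \<Phi>_state_bound)

lemma expectation_\<Phi>_state_Suc:
  defines "g \<equiv> \<lambda>n \<omega>. if state n \<omega> \<in> A then \<integral>\<omega>'. \<Phi> (F n (state n \<omega>) (\<xi> (Suc n) \<omega>')) \<partial>M else \<Phi> (state n \<omega>)"
  shows "integrable M (g n)" and "expectation (\<lambda>\<omega>. \<Phi> (state (Suc n) \<omega>)) = expectation (g n)"
proof -
  let ?h = "\<lambda>(s, x). \<Phi> (stop_outside A F n s x)"
  have h: "?h \<in> borel_measurable (borel \<Otimes>\<^sub>M N)"
    using measurable_compose[OF stop_measurable \<Phi>_measurable] by (simp add: case_prod_beta')
  have eq: "?h (state n \<omega>, \<xi> (Suc n) \<omega>) = \<Phi> (state (Suc n) \<omega>)" for \<omega>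
    by (simp add: state_def)
  have "integrable M (\<lambda>\<omega>. ?h (state n \<omega>, \<xi> (Suc n) \<omega>))"
    unfolding eq by simp
  note I = integral_chain_step[where F = "stop_outside A F" and c = c and n = n, OF indep stop_measurable _ h,
      folded state_def, OF _ this, unfolded eq]
  moreover have "(\<integral>\<omega>'. ?h (state n \<omega>, \<xi> (Suc n) \<omega>') \<partial>M) = g n \<omega>" for \<omega>
    by (simp add: stop_outside_def g_def prob_space)
  ultimately show "integrable M (g n)" and "expectation (\<lambda>\<omega>. \<Phi> (state (Suc n) \<omega>)) = expectation (g n)"
    by simp_all
qed

lemma expectation_state_le:
  assumes step: "\<And>n s. s \<in> A \<Longrightarrow> expectation (\<lambda>\<omega>. \<Phi> (F n s (\<xi> (Suc n) \<omega>))) \<le> \<Phi> s + a n"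
    and nonneg: "\<And>n. 0 \<le> a n"
  shows "expectation (\<lambda>\<omega>. \<Phi> (state n \<omega>)) \<le> \<Phi> c + (\<Sum>j<n. a j)"
proof (induction n)
  case (Suc n)
  have "expectation (\<lambda>\<omega>. \<Phi> (state (Suc n) \<omega>)) \<le> expectation (\<lambda>\<omega>. \<Phi> (state n \<omega>) + a n)"
    unfolding expectation_\<Phi>_state_Suc(2)
    by (intro integral_mono expectation_\<Phi>_state_Suc(1)) (auto simp: step nonneg)
  with Suc show ?case
    by (simp add: prob_space)
qed (simp add: state_def prob_space)

lemma expectation_state_ge:
  assumes step: "\<And>n s. s \<in> A \<Longrightarrow> \<Phi> s + a n \<le> expectation (\<lambda>\<omega>. \<Phi> (F n s (\<xi> (Suc n) \<omega>)))"
  shows "\<Phi> c + (\<Sum>j<n. a j * prob {\<omega> \<in> space M. state j \<omega> \<in> A}) \<le> expectation (\<lambda>\<omega>. \<Phi> (state n \<omega>))"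
proof (induction n)
  case (Suc n)
  let ?I = "indicator {\<omega> \<in> space M. state n \<omega> \<in> A} :: 'a \<Rightarrow> real"
  have I: "integrable M (\<lambda>\<omega>. a n * ?I \<omega>)"
    by (intro integrable_mult_right integrable_real_indicator)
       (measurable, simp add: less_top[symmetric])
  then have int: "integrable M (\<lambda>\<omega>. \<Phi> (state n \<omega>) + a n * ?I \<omega>)"
    by (intro Bochner_Integration.integrable_add integrable_\<Phi>_state)
  have "expectation (\<lambda>\<omega>. \<Phi> (state n \<omega>) + a n * ?I \<omega>) \<le> expectation (\<lambda>\<omega>. \<Phi> (state (Suc n) \<omega>))"
    unfolding expectation_\<Phi>_state_Suc(2)
    by (intro integral_mono int expectation_\<Phi>_state_Suc(1)) (auto simp: step indicator_def)
  also have "expectation (\<lambda>\<omega>. \<Phi> (state n \<omega>) + a n * ?I \<omega>) =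
      expectation (\<lambda>\<omega>. \<Phi> (state n \<omega>)) + a n * prob {\<omega> \<in> space M. state n \<omega> \<in> A}"
    using I by simp
  finally show ?case
    using Suc by simp
qed (simp add: state_def prob_space)

end

section \<open>Independent factors near the identity\<close>

lemma (in prob_space) expectation_norm_power2_add:
  fixes V :: "'a \<Rightarrow> 'v::{real_inner, banach, second_countable_topology}"
  assumes V [measurable]: "V \<in> borel_measurable M" and bound: "\<And>\<omega>. \<omega> \<in> space M \<Longrightarrow> norm (V \<omega>) \<le> K"
  shows "expectation (\<lambda>\<omega>. (norm (a + V \<omega>))\<^sup>2) =
    (norm a)\<^sup>2 + 2 * (a \<bullet> expectation V) + expectation (\<lambda>\<omega>. (norm (V \<omega>))\<^sup>2)"
proof -
  have V1: "integrable M V"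
    by (rule integrable_const_bound[where B = K]) (auto simp: bound)
  have V2: "integrable M (\<lambda>\<omega>. (norm (V \<omega>))\<^sup>2)"
    by (rule integrable_const_bound[where B = "K\<^sup>2"]) (auto simp: bound power_mono)
  have "(norm (a + v))\<^sup>2 = (norm a)\<^sup>2 + (2 * (a \<bullet> v) + (norm v)\<^sup>2)" for v
    by (simp add: power2_norm_eq_inner inner_add inner_commute)
  with V1 V2 show ?thesis
    by (simp add: prob_space)
qed

lemma (in prob_space) prob_tendsto_0_if_AE_eventually_not:
  assumes meas: "\<And>m. {\<omega> \<in> space M. P m \<omega>} \<in> events"
    and ae: "AE \<omega> in M. \<forall>\<^sub>F m in sequentially. \<not> P m \<omega>"
  shows "(\<lambda>m. prob {\<omega> \<in> space M. P m \<omega>}) \<longlonglongrightarrow> 0"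
proof -
  have "(\<lambda>m. expectation (indicator {\<omega> \<in> space M. P m \<omega>})) \<longlonglongrightarrow> expectation (\<lambda>_. 0 :: real)"
  proof (rule integral_dominated_convergence[where w = "\<lambda>_. 1"])
    show "AE \<omega> in M. (\<lambda>m. indicator {\<omega> \<in> space M. P m \<omega>} \<omega> :: real) \<longlonglongrightarrow> 0"
      using ae
    proof eventually_elim
      case (elim \<omega>)
      then have "\<forall>\<^sub>F m in sequentially. indicator {\<omega> \<in> space M. P m \<omega>} \<omega> = (0 :: real)"
        by eventually_elim simp
      then show ?case by (rule tendsto_eventually)
    qed
  qed (use meas in \<open>auto simp: indicator_def\<close>)
  then show ?thesis
    using meas by simp
qed

lemma suminf_tail_tendsto_0:
  fixes f :: "nat \<Rightarrow> real"
  assumes "summable f"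
  shows "(\<lambda>m. \<Sum>j. f (j + m)) \<longlonglongrightarrow> 0"
proof -
  have "(\<lambda>m. suminf f - sum f {..<m}) \<longlonglongrightarrow> suminf f - suminf f"
    by (intro tendsto_diff tendsto_const summable_LIMSEQ assms)
  then show ?thesis
    using assms by (simp add: suminf_minus_initial_segment)
qed

lemma (in prob_space) indep_vars_reindex:
  assumes indep: "indep_vars M' X (f ` I)" and inj: "inj_on f I"
  shows "indep_vars (\<lambda>i. M' (f i)) (\<lambda>i. X (f i)) I"
proof -
  let ?E = "\<lambda>i. {X i -` A \<inter> space M | A. A \<in> sets (M' i)}"
  have rv: "\<forall>i\<in>f ` I. random_variable (M' i) (X i)" and E: "indep_sets ?E (f ` I)"
    using indep by (auto simp: indep_vars_def2)
  have "indep_sets (\<lambda>i. ?E (f i)) I"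
  proof (rule indep_setsI)
    show "?E (f i) \<subseteq> events" if "i \<in> I" for i
      using rv that by (auto intro: measurable_sets)
    fix A J assume J: "J \<noteq> {}" "J \<subseteq> I" "finite J" and A: "\<forall>j\<in>J. A j \<in> ?E (f j)"
    have injJ: "inj_on f J"
      using inj J(2) by (rule inj_on_subset)
    let ?A = "\<lambda>k. A (the_inv_into J f k)"
    have inv: "\<And>j. j \<in> J \<Longrightarrow> the_inv_into J f (f j) = j"
      using injJ by (rule the_inv_into_f_f)
    have "prob (\<Inter>k\<in>f ` J. ?A k) = (\<Prod>k\<in>f ` J. prob (?A k))"
      using J A inv by (intro indep_setsD[OF E]) auto
    then show "prob (\<Inter>j\<in>J. A j) = (\<Prod>j\<in>J. prob (A j))"
      using injJ inv by (simp add: prod.reindex)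
  qed
  then show ?thesis
    using rv by (simp add: indep_vars_def2)
qed

text \<open>
  Rectangles are products of events of the two coordinates, and the probability of an intersection
  of rectangles factors over the coordinates as well as, by independence, over the indices. The
  rectangles form an intersection-stable generator, which gives independence of the generated
  \<open>\<sigma>\<close>-algebras.
\<close>

lemma (in prob_space) indep_vars_two_copies:
  assumes indep: "indep_vars (\<lambda>_. N) X I"
  shows "prob_space.indep_vars (M \<Otimes>\<^sub>M M) (\<lambda>_. N \<Otimes>\<^sub>M N) (\<lambda>i p. (X i (fst p), X i (snd p))) I"
proof -
  interpret MM: pair_prob_space M M ..
  let ?MM = "M \<Otimes>\<^sub>M M"
  let ?pre = "\<lambda>i A. X i -` A \<inter> space M"
  let ?E = "\<lambda>i. {?pre i A \<times> ?pre i B | A B. A \<in> sets N \<and> B \<in> sets N}"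
  have rv [measurable]: "\<And>i. i \<in> I \<Longrightarrow> X i \<in> M \<rightarrow>\<^sub>M N"
    using indep by (auto simp: indep_vars_def2)
  have E: "indep_sets (\<lambda>i. {?pre i A | A. A \<in> sets N}) I"
    using indep by (auto simp: indep_vars_def2)
  have rect: "MM.prob (A \<times> B) = prob A * prob B" if "A \<in> events" "B \<in> events" for A B
    using that emeasure_pair_measure_Times[of A M B]
    by (simp add: measure_def enn2real_mult)
  have "MM.indep_sets ?E I"
  proof (rule MM.indep_setsI)
    show "?E i \<subseteq> MM.events" if "i \<in> I" for i
      using that by (auto intro!: pair_measureI measurable_sets[OF rv])
    fix R J assume J: "J \<noteq> {}" "J \<subseteq> I" "finite J" and R: "\<forall>j\<in>J. R j \<in> ?E j"
    have "\<forall>j\<in>J. \<exists>A B. R j = ?pre j A \<times> ?pre j B \<and> A \<in> sets N \<and> B \<in> sets N"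
      using R by auto
    then obtain A B where AB: "\<And>j. j \<in> J \<Longrightarrow> R j = ?pre j (A j) \<times> ?pre j (B j)"
        "\<And>j. j \<in> J \<Longrightarrow> A j \<in> sets N" "\<And>j. j \<in> J \<Longrightarrow> B j \<in> sets N"
      by metis
    have ev: "?pre j (A j) \<in> events" "?pre j (B j) \<in> events" if "j \<in> J" for j
      using that J(2) AB(2,3) by (auto intro!: measurable_sets[OF rv])
    have "(\<Inter>j\<in>J. R j) = (\<Inter>j\<in>J. ?pre j (A j)) \<times> (\<Inter>j\<in>J. ?pre j (B j))"
      using AB(1) J(1) by auto
    then have "MM.prob (\<Inter>j\<in>J. R j) = prob (\<Inter>j\<in>J. ?pre j (A j)) * prob (\<Inter>j\<in>J. ?pre j (B j))"
      by (simp only:) (intro rect sets.finite_INT ev J)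
    also have "prob (\<Inter>j\<in>J. ?pre j (A j)) = (\<Prod>j\<in>J. prob (?pre j (A j)))"
      using J AB(2) by (intro indep_setsD[OF E]) auto
    also have "prob (\<Inter>j\<in>J. ?pre j (B j)) = (\<Prod>j\<in>J. prob (?pre j (B j)))"
      using J AB(3) by (intro indep_setsD[OF E]) auto
    also have "(\<Prod>j\<in>J. prob (?pre j (A j))) * (\<Prod>j\<in>J. prob (?pre j (B j))) = (\<Prod>j\<in>J. MM.prob (R j))"
      using rect ev AB(1) by (simp add: prod.distrib[symmetric])
    finally show "MM.prob (\<Inter>j\<in>J. R j) = (\<Prod>j\<in>J. MM.prob (R j))" .
  qed
  moreover have "Int_stable (?E i)" for i
  proof (rule Int_stableI)
    fix S T assume "S \<in> ?E i" "T \<in> ?E i"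
    then obtain A B A' B' where "S = ?pre i A \<times> ?pre i B" "T = ?pre i A' \<times> ?pre i B'"
      and N: "A \<in> sets N" "B \<in> sets N" "A' \<in> sets N" "B' \<in> sets N"
      by auto
    then have "S \<inter> T = ?pre i (A \<inter> A') \<times> ?pre i (B \<inter> B')"
      by auto
    with N show "S \<inter> T \<in> ?E i"
      by blast
  qed
  ultimately have sig: "MM.indep_sets (\<lambda>i. sigma_sets (space ?MM) (?E i)) I"
    by (rule MM.indep_sets_sigma)
  show ?thesis
    unfolding MM.indep_vars_def2
  proof (intro conjI ballI MM.indep_sets_mono_sets[OF sig])
    fix i assume i: "i \<in> I"
    then show "(\<lambda>p. (X i (fst p), X i (snd p))) \<in> ?MM \<rightarrow>\<^sub>M N \<Otimes>\<^sub>M N"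
      by measurable
    let ?S = "sigma (space ?MM) (?E i)"
    have E_sub: "?E i \<subseteq> Pow (space ?MM)"
      by (auto simp: space_pair_measure)
    have X_space: "X i \<omega> \<in> space N" if "\<omega> \<in> space M" for \<omega>
      using measurable_space[OF rv[OF i] that] .
    have "(\<lambda>p. X i (fst p)) -` A \<inter> space ?MM = ?pre i A \<times> ?pre i (space N)"
      "(\<lambda>p. X i (snd p)) -` A \<inter> space ?MM = ?pre i (space N) \<times> ?pre i A" for A
      using X_space by (auto simp: space_pair_measure)
    then have "(\<lambda>p. X i (fst p)) \<in> ?S \<rightarrow>\<^sub>M N" "(\<lambda>p. X i (snd p)) \<in> ?S \<rightarrow>\<^sub>M N"
      using E_sub X_space
      by (auto simp: measurable_def space_pair_measure sets_measure_of space_measure_of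
          intro!: sigma_sets.Basic)
    then have "(\<lambda>p. (X i (fst p), X i (snd p))) \<in> ?S \<rightarrow>\<^sub>M N \<Otimes>\<^sub>M N"
      by (rule measurable_Pair)
    from measurable_sets[OF this]
    show "{(\<lambda>p. (X i (fst p), X i (snd p))) -` A \<inter> space ?MM | A. A \<in> sets (N \<Otimes>\<^sub>M N)}
        \<subseteq> sigma_sets (space ?MM) (?E i)"
      using E_sub by (auto simp: sets_measure_of space_measure_of)
  qed
qed

text \<open>
  The situation after truncation. The condition \<open>r < 1\<close> makes all factors and their means
  invertible, with uniformly bounded inverses.
\<close>

locale near_identity_factors = prob_space M for M :: "'a measure" +
  fixes y :: "nat \<Rightarrow> 'a \<Rightarrow> real ^ 'k ^ 'k" and r :: real
  assumes indep: "indep_vars (\<lambda>_. borel) y {1..}"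
    and near: "\<And>i \<omega>. 1 \<le> i \<Longrightarrow> \<omega> \<in> space M \<Longrightarrow> norm (y i \<omega> - mat 1) \<le> r"
    and r_less_1: "r < 1"
begin

abbreviation mean :: "nat \<Rightarrow> real ^ 'k ^ 'k" where
  "mean i \<equiv> expectation (y i)"

abbreviation dispersion :: "nat \<Rightarrow> real" where
  "dispersion i \<equiv> expectation (\<lambda>\<omega>. (norm (y i \<omega> - mean i))\<^sup>2)"

abbreviation partial_prod :: "nat \<Rightarrow> 'a \<Rightarrow> real ^ 'k ^ 'k" where
  "partial_prod n \<omega> \<equiv> ordered_prod (\<lambda>i. y i \<omega>) n"

lemma y_measurable: "1 \<le> i \<Longrightarrow> y i \<in> borel_measurable M"
  using indep by (auto simp: indep_vars_def)

lemma y_Suc_measurable [measurable]: "y (Suc i) \<in> borel_measurable M"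
  by (simp add: y_measurable)

lemma partial_prod_measurable [measurable]: "partial_prod n \<in> borel_measurable M"
  by (induction n) auto

lemma r_nonneg: "0 \<le> r"
proof -
  obtain \<omega> where "\<omega> \<in> space M"
    using not_empty by blast
  from near[OF order_refl this] show ?thesis
    using norm_ge_zero order_trans by blast
qed

lemma y_in_GL: "1 \<le> i \<Longrightarrow> \<omega> \<in> space M \<Longrightarrow> y i \<omega> \<in> GL"
  using near_identity_in_GL near r_less_1 by blast

lemma y_integrable: "1 \<le> i \<Longrightarrow> integrable M (y i)"
proof (rule integrable_const_bound[where B = "r + norm (mat 1 :: real ^ 'k ^ 'k)"])
  assume i: "1 \<le> i"
  have "norm (y i \<omega>) \<le> r + norm (mat 1 :: real ^ 'k ^ 'k)" if "\<omega> \<in> space M" for \<omega>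
    using near[OF i that] norm_triangle_sub[of "y i \<omega>" "mat 1"] by simp
  then show "AE \<omega> in M. norm (y i \<omega>) \<le> r + norm (mat 1 :: real ^ 'k ^ 'k)"
    by simp
qed (rule y_measurable)

lemma mean_near: "1 \<le> i \<Longrightarrow> norm (mean i - mat 1) \<le> r"
proof -
  assume i: "1 \<le> i"
  have "mean i - mat 1 = expectation (\<lambda>\<omega>. y i \<omega> - mat 1)"
    using y_integrable[OF i] by (simp add: prob_space)
  also have "norm \<dots> \<le> expectation (\<lambda>\<omega>. norm (y i \<omega> - mat 1))"
    by (rule integral_norm_bound)
  also have "\<dots> \<le> expectation (\<lambda>_. r)"
    using y_integrable[OF i] near[OF i] by (intro integral_mono) auto
  finally show ?thesis by (simp add: prob_space)
qed

lemma mean_in_GL: "1 \<le> i \<Longrightarrow> mean i \<in> GL"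
  using near_identity_in_GL mean_near r_less_1 by blast

lemma deviation_bound:
  assumes "1 \<le> i" "\<omega> \<in> space M"
  shows "norm (y i \<omega> - mean i) \<le> 2"
  using norm_triangle_ineq4[of "y i \<omega> - mat 1" "mean i - mat 1"] near[OF assms] mean_near[OF assms(1)]
    r_less_1 by simp

lemma integrable_deviation_power2: "integrable M (\<lambda>\<omega>. (norm (y (Suc n) \<omega> - mean (Suc n)))\<^sup>2)"
proof (rule integrable_const_bound[where B = "2\<^sup>2"])
  show "AE \<omega> in M. norm ((norm (y (Suc n) \<omega> - mean (Suc n)))\<^sup>2) \<le> 2\<^sup>2"
    using power_mono[OF deviation_bound norm_ge_zero, of "Suc n" _ 2] by auto
qed measurable

lemma dispersion_nonneg: "0 \<le> dispersion i"
  by simp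

lemma shift: "near_identity_factors M (\<lambda>i. y (m + i)) r"
proof
  have "{m + 1..} \<subseteq> {1..}" by auto
  from indep_vars_subset[OF indep this] have "indep_vars (\<lambda>_. borel) y ((\<lambda>i. m + i) ` {1..})"
    by (metis image_add_atLeast)
  then show "indep_vars (\<lambda>_. borel) (\<lambda>i. y (m + i)) {1..}"
    by (rule indep_vars_reindex) simp
qed (auto simp: near r_less_1)

text \<open>
  Kolmogorov's inequality for the martingale \<open>Z n = P n ** matrix_inv (B n)\<close>, where \<open>P n\<close> and \<open>B n\<close> are the products of the
  factors and of their means. As long as \<open>Z n\<close> and \<open>B n\<close> are near the identity, the increment of
  \<open>Z\<close> is a linear image of the centred factor under a map of norm at most \<open>6 / (1 - r)\<close>, so each step
  raises the expected squared distance from the identity by at most a constant times the dispersion.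
  The means are controlled only for \<open>j < N\<close>: the bound on \<open>B N\<close> is what a later induction has to prove.
\<close>

lemma maximal_inequality:
  assumes B: "\<And>j. j < N \<Longrightarrow> norm (ordered_prod mean j - mat 1) \<le> 1 / 2" and d: "0 < d" "d \<le> 1"
  shows "prob {\<omega> \<in> space M. \<exists>n\<le>N.
      d < norm (partial_prod n \<omega> ** matrix_inv (ordered_prod mean n) - mat 1)}
    \<le> (6 / (1 - r))\<^sup>2 * (\<Sum>j<N. dispersion (Suc j)) / d\<^sup>2"
proof -
  define \<beta> where "\<beta> = ordered_prod mean"
  define K where "K = 6 / (1 - r)"
  \<comment> \<open>After time \<open>N\<close> the chain is constant, because nothing is known there about \<open>\<beta>\<close>.\<close>
  define F where "F n Z x = (if n < N then Z ** \<beta> n ** x ** matrix_inv (\<beta> (Suc n)) else Z)"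
    for n and Z x :: "real ^ 'k ^ 'k"
  define A :: "(real ^ 'k ^ 'k) set" where "A = {Z. norm (Z - mat 1) \<le> d}"
  define \<Phi> :: "real ^ 'k ^ 'k \<Rightarrow> real" where "\<Phi> Z = (norm (Z - mat 1))\<^sup>2" for Z
  have K: "0 < K"
    using r_less_1 by (simp add: K_def)
  have \<beta>_GL: "\<beta> n \<in> GL" for n
    unfolding \<beta>_def by (intro ordered_prod_in_GL mean_in_GL)
  \<comment> \<open>The constant \<open>6\<close> is the product of the factors \<open>1 + d \<le> 2\<close> from \<open>Z\<close>, \<open>3 / 2\<close> from \<open>\<beta> n\<close> and \<open>2\<close> from
      the inverse of \<open>\<beta> n\<close>; inverting the next mean contributes \<open>1 / (1 - r)\<close>. The step may
      take \<open>\<beta> (Suc n)\<close> away from the identity.\<close>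
  have incr: "norm (Z ** \<beta> n ** u ** matrix_inv (\<beta> (Suc n))) \<le> K * norm u"
    if Z: "Z \<in> A" and n: "n < N" for Z u n
  proof -
    have 1: "norm (\<beta> n - mat 1) \<le> 1 / 2"
      using B[OF n] by (simp add: \<beta>_def)
    have "Z ** \<beta> n ** u ** matrix_inv (\<beta> (Suc n)) =
        Z ** (\<beta> n ** (u ** matrix_inv (mean (Suc n)) ** matrix_inv (\<beta> n)))"
      using \<beta>_GL[of n] mean_in_GL[of "Suc n"]
      by (simp add: \<beta>_def matrix_inv_matrix_mult matrix_mul_assoc)
    also have "norm \<dots> \<le> (1 + d) * norm (\<beta> n ** (u ** matrix_inv (mean (Suc n)) ** matrix_inv (\<beta> n)))"
      using Z by (intro near_identity_mult_left) (simp add: A_def)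
    also have "\<dots> \<le> 2 * ((1 + 1 / 2) * norm (u ** matrix_inv (mean (Suc n)) ** matrix_inv (\<beta> n)))"
      using d by (intro mult_mono near_identity_mult_left[OF 1]) auto
    also have "\<dots> \<le> 2 * ((1 + 1 / 2) * (norm (u ** matrix_inv (mean (Suc n))) / (1 - 1 / 2)))"
      by (intro mult_left_mono norm_matrix_inv_near_identity(1)[OF 1]) auto
    also have "\<dots> \<le> 2 * ((1 + 1 / 2) * (norm u / (1 - r) / (1 - 1 / 2)))"
      by (intro mult_left_mono divide_right_mono
          norm_matrix_inv_near_identity(1)[OF mean_near r_less_1]) auto
    finally show ?thesis
      by (simp add: K_def)
  qed
  have F_eq: "F n Z x - mat 1 = (Z - mat 1) + Z ** \<beta> n ** (x - mean (Suc n)) ** matrix_inv (\<beta> (Suc n))"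
    if "n < N" for n Z x
  proof -
    have "Z ** \<beta> n ** mean (Suc n) ** matrix_inv (\<beta> (Suc n)) = Z"
      using matrix_inv_mult(1)[OF \<beta>_GL[of "Suc n"]]
      by (simp add: \<beta>_def matrix_mul_assoc[symmetric])
    then show ?thesis
      using that by (simp add: F_def matrix_mult.diff_right matrix_mult.diff_left)
  qed
  have \<Phi>_step: "\<Phi> (F n Z (y (Suc n) \<omega>)) \<le> (1 + K * 2)\<^sup>2" if "Z \<in> A" "\<omega> \<in> space M" for n Z \<omega>
  proof (cases "n < N")
    case True
    have "norm (F n Z (y (Suc n) \<omega>) - mat 1) \<le> d + K * norm (y (Suc n) \<omega> - mean (Suc n))"
      unfolding F_eq[OF True] using that
      by (intro norm_triangle_mono incr True) (auto simp: A_def)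
    also have "\<dots> \<le> 1 + K * 2"
      using d K that deviation_bound[of "Suc n" \<omega>] by (intro add_mono mult_left_mono) auto
    finally show ?thesis
      unfolding \<Phi>_def by (intro power_mono) auto
  next
    case False
    then show ?thesis
      using that d K unfolding \<Phi>_def by (intro power_mono) (auto simp: F_def A_def)
  qed
  interpret stopped_chain M y borel F A "mat 1" \<Phi> "(1 + K * 2)\<^sup>2"
  proof
    show "(\<lambda>(s, x). F n s x) \<in> borel \<Otimes>\<^sub>M borel \<rightarrow>\<^sub>M borel" for n
      unfolding F_def case_prod_beta' by measurable
    show "A \<in> sets borel"
      unfolding A_def by measurable
    show "\<Phi> Z \<le> (1 + K * 2)\<^sup>2" if "Z \<in> A" for Z
      using that d K unfolding \<Phi>_def A_def by (intro power_mono) auto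
    show "\<Phi> \<in> borel_measurable borel"
      unfolding \<Phi>_def[abs_def] by measurable
    show "indep_vars (\<lambda>_. borel) y {1..}"
      by (rule indep)
  qed (use \<Phi>_step d in \<open>auto simp: \<Phi>_def A_def\<close>)
  define a where "a n = (if n < N then K\<^sup>2 * dispersion (Suc n) else 0)" for n
  have "expectation (\<lambda>\<omega>. \<Phi> (F n Z (y (Suc n) \<omega>))) \<le> \<Phi> Z + a n" if Z: "Z \<in> A" for n Z
  proof (cases "n < N")
    case True
    define L where "L u = Z ** \<beta> n ** u ** matrix_inv (\<beta> (Suc n))" for u
    have L_bound: "norm (L u) \<le> K * norm u" for u
      unfolding L_def by (rule incr[OF Z True])
    have L: "bounded_linear L"
      unfolding L_def
      by (intro bounded_linear_compose[OF matrix_mult.bounded_linear_left] matrix_mult.bounded_linear_right)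
    have meas: "(\<lambda>\<omega>. L (y (Suc n) \<omega> - mean (Suc n))) \<in> borel_measurable M"
      unfolding L_def by measurable
    have "expectation (\<lambda>\<omega>. L (y (Suc n) \<omega> - mean (Suc n))) = L (expectation (\<lambda>\<omega>. y (Suc n) \<omega> - mean (Suc n)))"
      using y_integrable by (intro integral_bounded_linear[OF L]) auto
    also have "expectation (\<lambda>\<omega>. y (Suc n) \<omega> - mean (Suc n)) = 0"
      using y_integrable[of "Suc n"] by (simp add: prob_space)
    finally have 0: "expectation (\<lambda>\<omega>. L (y (Suc n) \<omega> - mean (Suc n))) = 0"
      by (simp add: L_def)
    have "expectation (\<lambda>\<omega>. \<Phi> (F n Z (y (Suc n) \<omega>))) =
        expectation (\<lambda>\<omega>. (norm ((Z - mat 1) + L (y (Suc n) \<omega> - mean (Suc n))))\<^sup>2)"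
      unfolding \<Phi>_def F_eq[OF True] L_def ..
    also have "\<dots> = (norm (Z - mat 1))\<^sup>2 + expectation (\<lambda>\<omega>. (norm (L (y (Suc n) \<omega> - mean (Suc n))))\<^sup>2)"
    proof (subst expectation_norm_power2_add[OF meas])
      show "norm (L (y (Suc n) \<omega> - mean (Suc n))) \<le> K * 2" if "\<omega> \<in> space M" for \<omega>
        using L_bound[of "y (Suc n) \<omega> - mean (Suc n)"] deviation_bound[of "Suc n" \<omega>] that K
        by (auto intro: order_trans mult_left_mono)
    qed (simp add: 0)
    also have "expectation (\<lambda>\<omega>. (norm (L (y (Suc n) \<omega> - mean (Suc n))))\<^sup>2) \<le>
        expectation (\<lambda>\<omega>. K\<^sup>2 * (norm (y (Suc n) \<omega> - mean (Suc n)))\<^sup>2)"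
    proof (rule integral_mono')
      have "integrable M (\<lambda>\<omega>. (norm (y (Suc n) \<omega> - mean (Suc n)))\<^sup>2)"
        by (rule integrable_deviation_power2)
      then show "integrable M (\<lambda>\<omega>. K\<^sup>2 * (norm (y (Suc n) \<omega> - mean (Suc n)))\<^sup>2)"
        by simp
      show "(norm (L (y (Suc n) \<omega> - mean (Suc n))))\<^sup>2 \<le> K\<^sup>2 * (norm (y (Suc n) \<omega> - mean (Suc n)))\<^sup>2" for \<omega>
        using power_mono[OF L_bound norm_ge_zero] by (simp add: power_mult_distrib)
    qed simp
    finally show ?thesis
      using True by (simp add: \<Phi>_def a_def)
  next
    case False
    then show ?thesis
      by (simp add: F_def a_def prob_space)
  qed
  then have "expectation (\<lambda>\<omega>. \<Phi> (state N \<omega>)) \<le> \<Phi> (mat 1) + (\<Sum>j<N. a j)"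
  proof (rule expectation_state_le)
    show "0 \<le> a n" for n
      unfolding a_def by (cases "n < N") (simp_all add: mult_nonneg_nonneg dispersion_nonneg)
  qed
  also have "\<dots> = K\<^sup>2 * (\<Sum>j<N. dispersion (Suc j))"
    by (simp add: \<Phi>_def a_def sum_distrib_left)
  finally have E: "expectation (\<lambda>\<omega>. \<Phi> (state N \<omega>)) \<le> K\<^sup>2 * (\<Sum>j<N. dispersion (Suc j))" .
  have chain_eq: "chain F (mat 1) (\<lambda>i. y i \<omega>) n = partial_prod n \<omega> ** matrix_inv (\<beta> n)" if "n \<le> N" for n \<omega>
    using that
  proof (induction n)
    case 0
    then show ?case by (simp add: \<beta>_def matrix_inv_unique)
  next
    case (Suc n)
    then show ?case
      by (simp add: F_def matrix_inv_cancel[OF \<beta>_GL])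
  qed
  have "prob {\<omega> \<in> space M. \<exists>n\<le>N. d < norm (partial_prod n \<omega> ** matrix_inv (\<beta> n) - mat 1)}
      \<le> prob {\<omega> \<in> space M. d\<^sup>2 \<le> \<Phi> (state N \<omega>)}"
  proof (rule finite_measure_mono)
    show "{\<omega> \<in> space M. \<exists>n\<le>N. d < norm (partial_prod n \<omega> ** matrix_inv (\<beta> n) - mat 1)}
        \<subseteq> {\<omega> \<in> space M. d\<^sup>2 \<le> \<Phi> (state N \<omega>)}"
    proof clarify
      fix \<omega> n assume n: "n \<le> N" "d < norm (partial_prod n \<omega> ** matrix_inv (\<beta> n) - mat 1)"
      then have "chain F (mat 1) (\<lambda>i. y i \<omega>) n \<notin> A"
        by (simp add: chain_eq A_def)
      then have "state N \<omega> \<notin> A"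
        using chain_stop_outside_in n(1) unfolding state_def by metis
      then show "d\<^sup>2 \<le> \<Phi> (state N \<omega>)"
        unfolding A_def \<Phi>_def using d by (intro power_mono) auto
    qed
  qed measurable
  also have "\<dots> \<le> expectation (\<lambda>\<omega>. \<Phi> (state N \<omega>)) / d\<^sup>2"
    by (rule integral_Markov_inequality_measure[where A = "{}"]) (use d \<Phi>_nonneg in auto)
  also have "\<dots> \<le> K\<^sup>2 * (\<Sum>j<N. dispersion (Suc j)) / d\<^sup>2"
    using E by (rule divide_right_mono) simp
  finally show ?thesis
    by (simp add: \<beta>_def K_def)
qed

section \<open>Products and products of means\<close>

text \<open>
  If the means stay near the identity, so does the product with high probability, because
  \<open>P - I = (Z - I) ** B + (B - I)\<close>.
\<close>

lemma prob_product_leaves_le: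
  assumes means: "\<And>n. norm (ordered_prod mean n - mat 1) \<le> e / 2" and e: "0 < e" "e \<le> 1"
    and summable: "summable (\<lambda>j. dispersion (Suc j))"
  shows "prob {\<omega> \<in> space M. \<exists>n. e < norm (partial_prod n \<omega> - mat 1)}
    \<le> (6 / (1 - r))\<^sup>2 * (\<Sum>j. dispersion (Suc j)) / (e / 3)\<^sup>2"
proof -
  define S where "S N = {\<omega> \<in> space M. \<exists>n\<le>N. e < norm (partial_prod n \<omega> - mat 1)}" for N
  have S [measurable]: "S N \<in> events" for N
    unfolding S_def by measurable
  have S_le: "prob (S N) \<le> (6 / (1 - r))\<^sup>2 * (\<Sum>j. dispersion (Suc j)) / (e / 3)\<^sup>2" for N
  proof -
    have "S N \<subseteq> {\<omega> \<in> space M. \<exists>n\<le>N. e / 3 <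
        norm (partial_prod n \<omega> ** matrix_inv (ordered_prod mean n) - mat 1)}" (is "_ \<subseteq> ?T")
      unfolding S_def
    proof (intro subsetI CollectI, elim CollectE conjE exE, intro conjI exI)
      fix \<omega> n assume *: "n \<le> N" "e < norm (partial_prod n \<omega> - mat 1)"
      let ?\<beta> = "ordered_prod mean n" and ?P = "partial_prod n \<omega>"
      let ?Z = "?P ** matrix_inv ?\<beta>"
      have GL: "?\<beta> \<in> GL"
        by (intro ordered_prod_in_GL mean_in_GL)
      have "?P - mat 1 = (?Z - mat 1) ** ?\<beta> + (?\<beta> - mat 1)"
        by (simp add: matrix_mult.diff_left matrix_inv_cancel[OF GL])
      then have "norm (?P - mat 1) \<le> norm ((?Z - mat 1) ** ?\<beta>) + norm (?\<beta> - mat 1)"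
        by (metis norm_triangle_ineq)
      also have "\<dots> \<le> (1 + e / 2) * norm (?Z - mat 1) + e / 2"
        by (intro add_mono near_identity_mult_right means)
      also have "\<dots> \<le> (1 + 1 / 2) * norm (?Z - mat 1) + e / 2"
        using e by (intro add_mono mult_right_mono) auto
      finally show "e / 3 < norm (?Z - mat 1)"
        using *(2) by simp
    qed
    then have "prob (S N) \<le> prob ?T"
      by (intro finite_measure_mono) measurable
    also have "\<dots> \<le> (6 / (1 - r))\<^sup>2 * (\<Sum>j<N. dispersion (Suc j)) / (e / 3)\<^sup>2"
    proof (rule maximal_inequality)
      show "norm (ordered_prod mean j - mat 1) \<le> 1 / 2" for j
        using means[of j] e by linarith
    qed (use e in auto)
    also have "\<dots> \<le> (6 / (1 - r))\<^sup>2 * (\<Sum>j. dispersion (Suc j)) / (e / 3)\<^sup>2"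
      by (intro divide_right_mono mult_left_mono sum_le_suminf summable) (auto simp: dispersion_nonneg)
    finally show ?thesis .
  qed
  have "(\<lambda>N. prob (S N)) \<longlonglongrightarrow> prob (\<Union>N. S N)"
    by (rule finite_Lim_measure_incseq) (auto simp: incseq_def S_def intro: order_trans)
  then have "prob (\<Union>N. S N) \<le> (6 / (1 - r))\<^sup>2 * (\<Sum>j. dispersion (Suc j)) / (e / 3)\<^sup>2"
    by (rule LIMSEQ_le_const2) (use S_le in auto)
  also have "(\<Union>N. S N) = {\<omega> \<in> space M. \<exists>n. e < norm (partial_prod n \<omega> - mat 1)}"
    by (auto simp: S_def)
  finally show ?thesis .
qed

text \<open>
  Applied to the factors after time \<open>m\<close>, the previous bound involves only a tail of the series of
  dispersions. The event that no block product stays near the identity therefore has probability zero.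
\<close>

theorem product_converges_if_means_converge:
  assumes means: "converges_in_GL (ordered_prod mean)"
    and summable: "summable (\<lambda>j. dispersion (Suc j))"
  shows "AE \<omega> in M. converges_in_GL (\<lambda>n. partial_prod n \<omega>)"
proof -
  define P where "P m n \<omega> = ordered_prod (\<lambda>i. y (m + i) \<omega>) n" for m n \<omega>
  have P_measurable [measurable]: "P m n \<in> borel_measurable M" for m n
  proof -
    interpret shifted: near_identity_factors M "\<lambda>i. y (m + i)" r
      by (rule shift)
    show ?thesis
      unfolding P_def by measurable
  qed
  have "AE \<omega> in M. \<exists>m. \<forall>n. norm (P m n \<omega> - mat 1) \<le> e" if e: "0 < e" "e \<le> 1" for e
  proof -
    define bad where "bad m = {\<omega> \<in> space M. \<exists>n. e < norm (P m n \<omega> - mat 1)}" for m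
    have [measurable]: "bad m \<in> events" for m
      unfolding bad_def by measurable
    have "\<forall>\<^sub>F m in sequentially. \<forall>n. norm (ordered_prod (\<lambda>i. mean (m + i)) n - mat 1) \<le> e / 2"
      using means mean_in_GL e by (intro converges_in_GL_ordered_prodD) auto
    then have upper: "\<forall>\<^sub>F m in sequentially. prob (bad m)
        \<le> (6 / (1 - r))\<^sup>2 * (\<Sum>j. dispersion (Suc (j + m))) / (e / 3)\<^sup>2"
    proof eventually_elim
      case (elim m)
      interpret shifted: near_identity_factors M "\<lambda>i. y (m + i)" r
        by (rule shift)
      have index: "m + Suc j = Suc (j + m)" for j
        by simp
      have "summable (\<lambda>j. dispersion (m + Suc j))"
        unfolding index using summable by (rule summable_ignore_initial_segment)
      from shifted.prob_product_leaves_le[OF _ e this] elim show ?case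
        unfolding bad_def P_def index by blast
    qed
    have "(\<lambda>m. (6 / (1 - r))\<^sup>2 * (\<Sum>j. dispersion (Suc (j + m))) / (e / 3)\<^sup>2)
        \<longlonglongrightarrow> (6 / (1 - r))\<^sup>2 * 0 / (e / 3)\<^sup>2"
      using e by (intro tendsto_intros suminf_tail_tendsto_0[OF summable]) auto
    then have upper_lim: "(\<lambda>m. (6 / (1 - r))\<^sup>2 * (\<Sum>j. dispersion (Suc (j + m))) / (e / 3)\<^sup>2)
        \<longlonglongrightarrow> 0"
      by simp
    have lim: "(\<lambda>m. prob (bad m)) \<longlonglongrightarrow> 0"
      by (rule tendsto_sandwich[OF _ upper tendsto_const upper_lim]) simp
    have "prob (\<Inter>m. bad m) \<le> prob (bad m)" for m
      by (intro finite_measure_mono) auto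
    then have "prob (\<Inter>m. bad m) \<le> 0"
      by (intro LIMSEQ_le_const[OF lim]) auto
    then have "emeasure M (\<Inter>m. bad m) = 0"
      by (simp add: emeasure_eq_measure measure_le_0_iff)
    then have "(\<Inter>m. bad m) \<in> null_sets M"
      by (intro null_setsI) auto
    from AE_not_in[OF this] AE_space show ?thesis
      by eventually_elim (auto simp: bad_def not_less)
  qed
  then have "AE \<omega> in M. \<forall>l. \<exists>m. \<forall>n. norm (P m n \<omega> - mat 1) \<le> 1 / real (Suc l)"
    by (subst AE_all_countable) (intro allI, simp)
  with AE_space show ?thesis
  proof eventually_elim
    case (elim \<omega>)
    have "converges_in_GL (ordered_prod (\<lambda>i. y i \<omega>))"
    proof (rule converges_in_GL_ordered_prodI)
      show "y i \<omega> \<in> GL" if "1 \<le> i" for i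
        using that elim(1) by (rule y_in_GL)
      fix e :: real assume "0 < e"
      then obtain l where l: "1 / real (Suc l) < e"
        using nat_approx_posE by metis
      obtain m where "\<And>n. norm (P m n \<omega> - mat 1) \<le> 1 / real (Suc l)"
        using elim(2) by blast
      with l show "\<exists>m. \<forall>n. norm (ordered_prod (\<lambda>i. y (m + i) \<omega>) n - mat 1) \<le> e"
        unfolding P_def by (meson less_imp_le order_trans)
    qed
    then show ?case by simp
  qed
qed

lemma prob_tail_leaves_tendsto_0:
  assumes conv: "AE \<omega> in M. converges_in_GL (\<lambda>n. partial_prod n \<omega>)" and "0 < e"
  shows "(\<lambda>m. prob {\<omega> \<in> space M. \<exists>n. e < norm (ordered_prod (\<lambda>i. y (m + i) \<omega>) n - mat 1)}) \<longlonglongrightarrow> 0"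
proof (rule prob_tendsto_0_if_AE_eventually_not)
  fix m
  interpret shifted: near_identity_factors M "\<lambda>i. y (m + i)" r
    by (rule shift)
  show "{\<omega> \<in> space M. \<exists>n. e < norm (ordered_prod (\<lambda>i. y (m + i) \<omega>) n - mat 1)} \<in> events"
    by measurable
next
  show "AE \<omega> in M. \<forall>\<^sub>F m in sequentially.
      \<not> (\<exists>n. e < norm (ordered_prod (\<lambda>i. y (m + i) \<omega>) n - mat 1))"
    using conv AE_space
  proof eventually_elim
    case (elim \<omega>)
    have "\<forall>\<^sub>F m in sequentially. \<forall>n. norm (ordered_prod (\<lambda>i. y (m + i) \<omega>) n - mat 1) \<le> e"
      using elim y_in_GL \<open>0 < e\<close> by (intro converges_in_GL_ordered_prodD) auto
    then show ?case
      by (simp add: not_less)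
  qed
qed

text \<open>
  Here the maximal inequality is read backwards. If the means stayed near the identity before time
  \<open>n\<close>, it applies up to time \<open>n\<close>. Both exceptional events have probability less than \<open>1 / 2\<close>, so at some
  sample point \<open>P n\<close> and \<open>Z n = P n ** matrix_inv (B n)\<close> are both near the identity; then so is the
  deterministic matrix \<open>B n\<close>.
\<close>

lemma means_stay_near_identity:
  assumes e: "0 < e" "e \<le> 1 / 2"
    and product: "prob {\<omega> \<in> space M. \<exists>n. e / 4 < norm (partial_prod n \<omega> - mat 1)} < 1 / 2"
    and summable: "summable (\<lambda>j. dispersion (Suc j))"
    and small: "(6 / (1 - r))\<^sup>2 * (\<Sum>j. dispersion (Suc j)) / (e / 4)\<^sup>2 < 1 / 2"
  shows "norm (ordered_prod mean n - mat 1) \<le> e"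
proof (induction n rule: less_induct)
  case (less n)
  let ?\<beta> = "ordered_prod mean n"
  let ?S = "{\<omega> \<in> space M. \<exists>n. e / 4 < norm (partial_prod n \<omega> - mat 1)}"
  let ?T = "{\<omega> \<in> space M. \<exists>j\<le>n. e / 4 <
      norm (partial_prod j \<omega> ** matrix_inv (ordered_prod mean j) - mat 1)}"
  have "prob ?T \<le> (6 / (1 - r))\<^sup>2 * (\<Sum>j<n. dispersion (Suc j)) / (e / 4)\<^sup>2"
  proof (rule maximal_inequality)
    show "norm (ordered_prod mean j - mat 1) \<le> 1 / 2" if "j < n" for j
      using less[OF that] e by linarith
  qed (use e in auto)
  also have "\<dots> \<le> (6 / (1 - r))\<^sup>2 * (\<Sum>j. dispersion (Suc j)) / (e / 4)\<^sup>2"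
    by (intro divide_right_mono mult_left_mono sum_le_suminf summable) (auto simp: dispersion_nonneg)
  finally have "prob ?S + prob ?T < 1"
    using product small by linarith
  moreover have "prob (?S \<union> ?T) \<le> prob ?S + prob ?T"
    by (intro measure_Un_le) measurable
  ultimately have "?S \<union> ?T \<noteq> space M"
    using prob_space by auto
  then obtain \<omega> where "\<omega> \<in> space M" "\<omega> \<notin> ?S" "\<omega> \<notin> ?T"
    by blast
  then have P: "norm (partial_prod n \<omega> - mat 1) \<le> e / 4"
    and Z: "norm (partial_prod n \<omega> ** matrix_inv ?\<beta> - mat 1) \<le> e / 4"
    by (auto simp: not_less)
  let ?P = "partial_prod n \<omega>" and ?Z = "partial_prod n \<omega> ** matrix_inv ?\<beta>"
  have GL: "?\<beta> \<in> GL"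
    by (intro ordered_prod_in_GL mean_in_GL)
  have "?Z ** (?\<beta> - mat 1) = (?P - mat 1) - (?Z - mat 1)"
    by (simp add: matrix_mult.diff_right matrix_inv_cancel[OF GL])
  then have "norm (?Z ** (?\<beta> - mat 1)) \<le> norm (?P - mat 1) + norm (?Z - mat 1)"
    by (simp only: norm_triangle_ineq4)
  also have "\<dots> \<le> e / 4 + e / 4"
    using P Z by (rule add_mono)
  finally have "norm (?Z ** (?\<beta> - mat 1)) \<le> e / 4 + e / 4" .
  moreover have "(1 - 1 / 2) * norm (?\<beta> - mat 1) \<le> (1 - e / 4) * norm (?\<beta> - mat 1)"
    using e by (intro mult_right_mono) auto
  moreover have "(1 - e / 4) * norm (?\<beta> - mat 1) \<le> norm (?Z ** (?\<beta> - mat 1))"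
    by (rule near_identity_mult_left(2)[OF Z])
  ultimately show ?case by simp
qed

theorem means_converge_if_product_converges:
  assumes conv: "AE \<omega> in M. converges_in_GL (\<lambda>n. partial_prod n \<omega>)"
    and summable: "summable (\<lambda>j. dispersion (Suc j))"
  shows "converges_in_GL (ordered_prod mean)"
proof (rule converges_in_GL_ordered_prodI)
  fix e :: real assume "0 < e"
  define e' where "e' = min e (1 / 2)"
  have e': "0 < e'" "e' \<le> 1 / 2" "e' \<le> e"
    using \<open>0 < e\<close> by (auto simp: e'_def)
  have "(\<lambda>m. (6 / (1 - r))\<^sup>2 * (\<Sum>j. dispersion (Suc (j + m))) / (e' / 4)\<^sup>2)
      \<longlonglongrightarrow> (6 / (1 - r))\<^sup>2 * 0 / (e' / 4)\<^sup>2"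
    using e' by (intro tendsto_intros suminf_tail_tendsto_0[OF summable]) auto
  then have "\<forall>\<^sub>F m in sequentially.
      (6 / (1 - r))\<^sup>2 * (\<Sum>j. dispersion (Suc (j + m))) / (e' / 4)\<^sup>2 < 1 / 2"
    by (rule order_tendstoD) simp
  moreover have "\<forall>\<^sub>F m in sequentially. prob {\<omega> \<in> space M. \<exists>n.
      e' / 4 < norm (ordered_prod (\<lambda>i. y (m + i) \<omega>) n - mat 1)} < 1 / 2"
    using e' by (intro order_tendstoD(2)[OF prob_tail_leaves_tendsto_0[OF conv]]) auto
  ultimately have "\<forall>\<^sub>F m in sequentially.
      \<forall>n. norm (ordered_prod (\<lambda>i. mean (m + i)) n - mat 1) \<le> e'"
  proof eventually_elim
    case (elim m)
    interpret shifted: near_identity_factors M "\<lambda>i. y (m + i)" r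
      by (rule shift)
    have index: "m + Suc j = Suc (j + m)" for j
      by simp
    have "summable (\<lambda>j. dispersion (m + Suc j))"
      unfolding index using summable by (rule summable_ignore_initial_segment)
    from shifted.means_stay_near_identity[OF e'(1,2) elim(2) this] elim(1) show ?case
      unfolding index by blast
  qed
  then show "\<exists>m. \<forall>n. norm (ordered_prod (\<lambda>i. mean (m + i)) n - mat 1) \<le> e"
    using e'(3) unfolding eventually_sequentially by (meson order_refl order_trans)
qed (rule mean_in_GL)

section \<open>Symmetrization\<close>

text \<open>
  Convergence of the product alone says nothing directly about the means of the factors. Their effect
  is removed by symmetrization: \<open>ratio i\<close> is a factor times the inverse of an independent copy of it,
  and has the same distribution as its own inverse. Outside the group \<^const>\<open>matrix_inv\<close> is an
  arbitrary choice; the default value \<open>mat 1\<close> makes the inverse a measurable function of the factor.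
\<close>

definition inverse_factor :: "nat \<Rightarrow> 'a \<Rightarrow> real ^ 'k ^ 'k" where
  "inverse_factor i \<omega> = (if y i \<omega> \<in> GL then matrix_inv (y i \<omega>) else mat 1)"

definition ratio :: "nat \<Rightarrow> 'a \<times> 'a \<Rightarrow> real ^ 'k ^ 'k" where
  "ratio i p = y i (fst p) ** inverse_factor i (snd p)"

definition ratio_spread :: "nat \<Rightarrow> real" where
  "ratio_spread i = (\<integral>p. (norm (ratio i p - mat 1))\<^sup>2 \<partial>(M \<Otimes>\<^sub>M M))"

lemma inverse_factor_eq: "1 \<le> i \<Longrightarrow> \<omega> \<in> space M \<Longrightarrow> inverse_factor i \<omega> = matrix_inv (y i \<omega>)"
  by (simp add: inverse_factor_def y_in_GL)

lemma inverse_factor_measurable [measurable]: "inverse_factor (Suc i) \<in> borel_measurable M"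
  unfolding inverse_factor_def[abs_def]
  using measurable_compose[OF y_Suc_measurable borel_measurable_matrix_inv_restrict] by simp

lemma ratio_measurable [measurable]: "ratio (Suc i) \<in> borel_measurable (M \<Otimes>\<^sub>M M)"
  unfolding ratio_def[abs_def] by measurable

lemma ratio_deviation:
  assumes "1 \<le> i" "p \<in> space (M \<Otimes>\<^sub>M M)"
  shows "ratio i p - mat 1 = (y i (fst p) - y i (snd p)) ** matrix_inv (y i (snd p))"
  using assms
  by (auto simp: ratio_def inverse_factor_eq space_pair_measure matrix_mult.diff_left
      matrix_inv_mult y_in_GL)

lemma ratio_deviation_bound:
  assumes "1 \<le> i" "p \<in> space (M \<Otimes>\<^sub>M M)"
  shows "norm (ratio i p - mat 1) \<le> 2 / (1 - r)"
proof -
  have p: "fst p \<in> space M" "snd p \<in> space M"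
    using assms(2) by (auto simp: space_pair_measure)
  have "norm (ratio i p - mat 1) \<le> norm (y i (fst p) - y i (snd p)) / (1 - r)"
    unfolding ratio_deviation[OF assms]
    by (rule norm_matrix_inv_near_identity(1)[OF near[OF assms(1) p(2)] r_less_1])
  also have "\<dots> \<le> 2 / (1 - r)"
    using norm_triangle_ineq4[of "y i (fst p) - mat 1" "y i (snd p) - mat 1"]
      near[OF assms(1) p(1)] near[OF assms(1) p(2)] r_less_1
    by (intro divide_right_mono) auto
  finally show ?thesis .
qed

lemma ratio_swap:
  assumes "1 \<le> i" "\<omega> \<in> space M" "\<omega>' \<in> space M"
  shows "ratio i (\<omega>, \<omega>') ** ratio i (\<omega>', \<omega>) = mat 1"
  using assms
  by (simp add: ratio_def inverse_factor_eq matrix_mul_assoc matrix_inv_cancel matrix_inv_mult y_in_GL)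

lemma integrable_ratio_deviation:
  "integrable (M \<Otimes>\<^sub>M M) (\<lambda>p. ratio (Suc i) p - mat 1)"
  "integrable (M \<Otimes>\<^sub>M M) (\<lambda>p. (norm (ratio (Suc i) p - mat 1))\<^sup>2)"
proof -
  interpret MM: pair_prob_space M M ..
  show "integrable (M \<Otimes>\<^sub>M M) (\<lambda>p. ratio (Suc i) p - mat 1)"
    by (rule MM.integrable_const_bound[where B = "2 / (1 - r)"])
       (use ratio_deviation_bound in \<open>auto intro!: AE_I2\<close>)
  show "integrable (M \<Otimes>\<^sub>M M) (\<lambda>p. (norm (ratio (Suc i) p - mat 1))\<^sup>2)"
  proof (rule MM.integrable_const_bound[where B = "(2 / (1 - r))\<^sup>2"])
    show "AE p in M \<Otimes>\<^sub>M M. norm ((norm (ratio (Suc i) p - mat 1))\<^sup>2) \<le> (2 / (1 - r))\<^sup>2"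
      using power_mono[OF ratio_deviation_bound norm_ge_zero, of "Suc i" _ 2] by (intro AE_I2) auto
  qed measurable
qed

text \<open>
  Exchanging the two coordinates turns \<open>z = ratio i\<close> into its inverse without changing expectations.
  With \<open>w\<close> for the inverse of \<open>z\<close>, one has
  \<open>z + w - 2 I = (z - I) ** (z - I) ** w\<close>, so the mean of \<open>z - I\<close> is of second order.
\<close>

lemma norm_expectation_ratio_deviation_le:
  "norm (\<integral>p. ratio (Suc i) p - mat 1 \<partial>(M \<Otimes>\<^sub>M M))
    \<le> ((1 + r) / (1 - r)) / 2 * ratio_spread (Suc i)"
proof -
  interpret MM: pair_prob_space M M ..
  let ?MM = "M \<Otimes>\<^sub>M M" and ?q = "ratio (Suc i)"
  let ?s = "\<lambda>p. (snd p, fst p)" and ?K = "(1 + r) / (1 - r)"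
  let ?E = "\<integral>p. ?q p - mat 1 \<partial>?MM"
  have swap: "(\<integral>p. ?q (?s p) - mat 1 \<partial>?MM) = ?E"
    using MM.integral_product_swap[of "\<lambda>p. ?q p - mat 1"] by (simp add: case_prod_beta')
  have swap_int: "integrable ?MM (\<lambda>p. ?q (?s p) - mat 1)"
    using MM.integrable_product_swap[OF integrable_ratio_deviation(1)[of i]]
    by (simp add: case_prod_beta')
  have "norm ((?q p - mat 1) + (?q (?s p) - mat 1)) \<le> ?K * (norm (?q p - mat 1))\<^sup>2"
    if "p \<in> space ?MM" for p
  proof -
    obtain \<omega> \<omega>' where p: "p = (\<omega>, \<omega>')" by (cases p)
    have \<omega>: "\<omega> \<in> space M" "\<omega>' \<in> space M"
      using that p by (auto simp: space_pair_measure)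
    let ?u = "?q p - mat 1"
    have inv: "?q p ** ?q (?s p) = mat 1"
      using ratio_swap[of "Suc i" \<omega> \<omega>'] p \<omega> by simp
    have "?u ** ?q (?s p) = mat 1 - ?q (?s p)"
      using inv by (simp add: matrix_mult.diff_left)
    then have "?u ** ?u ** ?q (?s p) = ?u ** (mat 1 - ?q (?s p))"
      by (simp only: matrix_mul_assoc[symmetric])
    also have "\<dots> = ?u - ?u ** ?q (?s p)"
      by (simp only: matrix_mult.diff_right matrix_mul_rid)
    also have "\<dots> = ?u + (?q (?s p) - mat 1)"
      unfolding \<open>?u ** ?q (?s p) = mat 1 - ?q (?s p)\<close> by (simp only: diff_conv_add_uminus[of ?u] minus_diff_eq)
    finally have "?u + (?q (?s p) - mat 1) = ?u ** ?u ** ?q (?s p)" ..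
    also have "\<dots> = ?u ** ?u ** y (Suc i) \<omega>' ** matrix_inv (y (Suc i) \<omega>)"
      using p \<omega> by (simp add: ratio_def inverse_factor_eq matrix_mul_assoc)
    also have "norm \<dots> \<le> norm (?u ** ?u ** y (Suc i) \<omega>') / (1 - r)"
      using \<omega> by (intro norm_matrix_inv_near_identity(1)[OF near r_less_1]) auto
    also have "\<dots> \<le> (1 + r) * norm (?u ** ?u) / (1 - r)"
      using \<omega> r_less_1 by (intro divide_right_mono near_identity_mult_right(1)[OF near]) auto
    also have "\<dots> \<le> (1 + r) * (norm ?u * norm ?u) / (1 - r)"
      using r_less_1 r_nonneg
      by (intro divide_right_mono mult_left_mono norm_matrix_mult_le) auto
    finally show ?thesis
      by (simp add: power2_eq_square)
  qed
  then have "(\<integral>p. norm ((?q p - mat 1) + (?q (?s p) - mat 1)) \<partial>?MM)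
      \<le> (\<integral>p. ?K * (norm (?q p - mat 1))\<^sup>2 \<partial>?MM)"
    using integrable_ratio_deviation[of i] swap_int
    by (intro integral_mono Bochner_Integration.integrable_add integrable_norm integrable_mult_right) auto
  also have "\<dots> = ?K * ratio_spread (Suc i)"
    by (simp add: ratio_spread_def)
  finally have "norm (\<integral>p. (?q p - mat 1) + (?q (?s p) - mat 1) \<partial>?MM) \<le> ?K * ratio_spread (Suc i)"
    by (rule order_trans[OF integral_norm_bound])
  also have "(\<integral>p. (?q p - mat 1) + (?q (?s p) - mat 1) \<partial>?MM) = ?E + ?E"
    using integrable_ratio_deviation(1)[of i] swap_int swap
    by (simp only: Bochner_Integration.integral_add)
  finally have "2 * norm ?E \<le> ?K * ratio_spread (Suc i)"
    by (simp only: scaleR_2[symmetric] norm_scaleR abs_numeral)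
  moreover have "a \<le> c / 2" if "2 * a \<le> c" for a c :: real
    using that by simp
  ultimately have "norm ?E \<le> ?K * ratio_spread (Suc i) / 2"
    by blast
  then show ?thesis
    by (simp only: times_divide_eq_left)
qed

text \<open>
  For independent copies \<open>y\<close> and \<open>y'\<close>, averaging \<open>y - y'\<close> over \<open>y'\<close> alone cannot increase the mean
  square, and leaves the deviation of \<open>y\<close> from its mean.
\<close>

lemma dispersion_le_ratio_spread: "dispersion (Suc i) \<le> 4 * ratio_spread (Suc i)"
proof -
  interpret MM: pair_prob_space M M ..
  let ?MM = "M \<Otimes>\<^sub>M M" and ?y = "y (Suc i)" and ?b = "mean (Suc i)"
  have bound: "(norm (?y (fst p) - ?y (snd p)))\<^sup>2 \<le> 4 * (norm (ratio (Suc i) p - mat 1))\<^sup>2"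
    if p: "p \<in> space ?MM" for p
  proof -
    have GL: "?y (snd p) \<in> GL" and n: "norm (?y (snd p) - mat 1) \<le> r"
      using p y_in_GL[of "Suc i"] near[of "Suc i"] by (auto simp: space_pair_measure)
    have "norm (?y (fst p) - ?y (snd p)) = norm ((ratio (Suc i) p - mat 1) ** ?y (snd p))"
      using p by (simp add: ratio_deviation matrix_inv_cancel[OF GL])
    also have "\<dots> \<le> (1 + r) * norm (ratio (Suc i) p - mat 1)"
      by (rule near_identity_mult_right(1)[OF n])
    also have "\<dots> \<le> 2 * norm (ratio (Suc i) p - mat 1)"
      using r_less_1 by (intro mult_right_mono) auto
    finally have "norm (?y (fst p) - ?y (snd p)) \<le> 2 * norm (ratio (Suc i) p - mat 1)" .
    from power_mono[OF this norm_ge_zero, of 2] show ?thesis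
      by (simp add: power_mult_distrib)
  qed
  have int: "integrable ?MM (\<lambda>p. (norm (?y (fst p) - ?y (snd p)))\<^sup>2)"
  proof (rule Bochner_Integration.integrable_bound)
    show "integrable ?MM (\<lambda>p. 4 * (norm (ratio (Suc i) p - mat 1))\<^sup>2)"
      using integrable_ratio_deviation(2) by simp
    show "AE p in ?MM. norm ((norm (?y (fst p) - ?y (snd p)))\<^sup>2)
        \<le> norm (4 * (norm (ratio (Suc i) p - mat 1))\<^sup>2)"
      using bound by (intro AE_I2) auto
  qed measurable
  have inner: "(norm (?y \<omega> - ?b))\<^sup>2 \<le> (\<integral>\<omega>'. (norm (?y \<omega> - ?y \<omega>'))\<^sup>2 \<partial>M)" for \<omega>
  proof -
    let ?V = "\<lambda>\<omega>'. ?b - ?y \<omega>'"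
    have "expectation ?V = 0"
      using y_integrable[of "Suc i"] by (simp add: prob_space)
    moreover have "norm (?V \<omega>') \<le> 2" if "\<omega>' \<in> space M" for \<omega>'
      using deviation_bound[of "Suc i" \<omega>'] that by (simp add: norm_minus_commute)
    ultimately have "expectation (\<lambda>\<omega>'. (norm ((?y \<omega> - ?b) + ?V \<omega>'))\<^sup>2) =
        (norm (?y \<omega> - ?b))\<^sup>2 + expectation (\<lambda>\<omega>'. (norm (?V \<omega>'))\<^sup>2)"
      by (subst expectation_norm_power2_add) auto
    then show ?thesis by simp
  qed
  have "dispersion (Suc i) \<le> (\<integral>\<omega>. (\<integral>\<omega>'. (norm (?y \<omega> - ?y \<omega>'))\<^sup>2 \<partial>M) \<partial>M)"
    using MM.integrable_fst'[OF int]
    by (intro integral_mono inner integrable_deviation_power2) simp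
  also have "\<dots> = (\<integral>p. (norm (?y (fst p) - ?y (snd p)))\<^sup>2 \<partial>?MM)"
    using MM.integral_fst'[OF int] by simp
  also have "\<dots> \<le> (\<integral>p. 4 * (norm (ratio (Suc i) p - mat 1))\<^sup>2 \<partial>?MM)"
    using integrable_ratio_deviation(2) by (intro integral_mono int bound) auto
  finally show ?thesis
    by (simp add: ratio_spread_def)
qed

text \<open>
  The squared distance of \<open>P ** z ** Q\<close> from the identity exceeds that of \<open>P ** Q\<close> by a cross
  term and the mean square of \<open>P ** (z - I) ** Q\<close>. The cross term is at most a multiple of
  \<open>e * ratio_spread\<close>, because the drift is of second order and \<open>P ** Q\<close> is within \<open>3 * e\<close> of the identity.
  The mean square is almost \<open>ratio_spread\<close>. The constant \<open>50\<close> makes \<open>e\<close> small enough for the second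
  term to win by half of \<open>ratio_spread\<close>.
\<close>

lemma expectation_conjugated_ratio_ge:
  fixes P Q :: "real ^ 'k ^ 'k"
  assumes e: "0 \<le> e" "50 * ((1 + r) / (1 - r)) * e \<le> 1"
    and P: "norm (P - mat 1) \<le> e" and Q: "norm (Q - mat 1) \<le> e"
  shows "(norm (P ** Q - mat 1))\<^sup>2 + ratio_spread (Suc i) / 2
    \<le> (\<integral>p. (norm (P ** ratio (Suc i) p ** Q - mat 1))\<^sup>2 \<partial>(M \<Otimes>\<^sub>M M))"
proof -
  interpret MM: pair_prob_space M M ..
  define K where "K = (1 + r) / (1 - r)"
  have K: "1 \<le> K"
    using r_nonneg r_less_1 by (simp add: K_def field_simps)
  then have "e * 1 \<le> e * K"
    using e(1) by (intro mult_left_mono)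
  moreover have eK: "e * K \<le> 1 / 50"
    using e(2) unfolding K_def[symmetric] by (simp add: mult.commute mult.left_commute)
  ultimately have e_le: "e \<le> 1 / 50"
    by simp
  let ?MM = "M \<Otimes>\<^sub>M M" and ?v = "ratio_spread (Suc i)"
  let ?u = "\<lambda>p. ratio (Suc i) p - mat 1"
  have v: "0 \<le> ?v"
    by (simp add: ratio_spread_def)
  have upper: "norm (P ** u ** Q) \<le> (1 + e) * ((1 + e) * norm u)" for u
    by (rule order_trans[OF near_identity_mult_right(1)[OF Q]
          mult_left_mono[OF near_identity_mult_left(1)[OF P]]]) (use e(1) in simp)
  have lower: "(1 - e) * ((1 - e) * norm u) \<le> norm (P ** u ** Q)" for u
    by (rule order_trans[OF mult_left_mono[OF near_identity_mult_left(2)[OF P]]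
          near_identity_mult_right(2)[OF Q]]) (use e_le in simp)
  have lin: "bounded_linear (\<lambda>u. P ** u ** Q)"
    by (intro bounded_linear_compose[OF matrix_mult.bounded_linear_left] matrix_mult.bounded_linear_right)
  have "norm (P ** Q - mat 1) = norm ((P - mat 1) ** Q + (Q - mat 1))"
    by (simp add: matrix_mult.diff_left)
  also have "\<dots> \<le> (1 + e) * e + e"
    by (intro norm_triangle_mono Q order_trans[OF near_identity_mult_right(1)[OF Q] mult_left_mono[OF P]])
       (use e(1) in simp)
  also have "\<dots> \<le> 3 * e"
    using mult_right_mono[of "1 + e" 2 e] e(1) e_le by simp
  finally have PQ: "norm (P ** Q - mat 1) \<le> 3 * e" .
  have E_lin: "(\<integral>p. P ** ?u p ** Q \<partial>?MM) = P ** (\<integral>p. ?u p \<partial>?MM) ** Q"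
    by (rule integral_bounded_linear[OF lin integrable_ratio_deviation(1)])
  have "norm (\<integral>p. P ** ?u p ** Q \<partial>?MM) \<le> (1 + e) * ((1 + e) * (K / 2 * ?v))"
    unfolding E_lin using e(1) norm_expectation_ratio_deviation_le[of i]
    by (intro order_trans[OF upper] mult_left_mono) (auto simp: K_def)
  also have "\<dots> \<le> (2 * (2 * (K / 2 * ?v)))"
    using e(1) e_le K v by (intro mult_mono) auto
  finally have drift: "norm (\<integral>p. P ** ?u p ** Q \<partial>?MM) \<le> 2 * (K * ?v)"
    by simp
  have "\<bar>(P ** Q - mat 1) \<bullet> (\<integral>p. P ** ?u p ** Q \<partial>?MM)\<bar> \<le> (3 * e) * (2 * (K * ?v))"
    by (rule order_trans[OF Cauchy_Schwarz_ineq2]) (intro mult_mono PQ drift, use e(1) in auto)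
  also have "\<dots> = 6 * (e * K) * ?v"
    by simp
  also have "\<dots> \<le> 6 * (1 / 50) * ?v"
    using eK v by (intro mult_right_mono mult_left_mono) auto
  finally have inner: "- (6 / 50 * ?v) \<le> (P ** Q - mat 1) \<bullet> (\<integral>p. P ** ?u p ** Q \<partial>?MM)"
    by linarith
  have conj_bound: "norm (P ** ?u p ** Q) \<le> (1 + e) * ((1 + e) * (2 / (1 - r)))"
    if "p \<in> space ?MM" for p
    using e(1) that by (intro order_trans[OF upper] mult_left_mono ratio_deviation_bound) auto
  have diffusion: "3 / 4 * ?v \<le> (\<integral>p. (norm (P ** ?u p ** Q))\<^sup>2 \<partial>?MM)"
  proof -
    have nine_tenths: "(9 / 10) * norm u \<le> norm (P ** u ** Q)" for u
    proof -
      have "(49 / 50) * (49 / 50) \<le> (1 - e) * (1 - e)"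
        using e_le by (intro mult_mono) auto
      then have "(9 / 10) * norm u \<le> ((1 - e) * (1 - e)) * norm u"
        by (intro mult_right_mono) auto
      also have "\<dots> \<le> norm (P ** u ** Q)"
        using lower[of u] by simp
      finally show ?thesis .
    qed
    have "3 / 4 * (norm u)\<^sup>2 \<le> (norm (P ** u ** Q))\<^sup>2" for u
    proof -
      have "3 / 4 * (norm u)\<^sup>2 \<le> ((9 / 10) * norm u)\<^sup>2"
        by (simp add: power_mult_distrib power2_eq_square)
      also have "\<dots> \<le> (norm (P ** u ** Q))\<^sup>2"
        by (intro power_mono nine_tenths) simp
      finally show ?thesis .
    qed
    moreover have "integrable ?MM (\<lambda>p. (norm (P ** ?u p ** Q))\<^sup>2)"
    proof (rule MM.integrable_const_bound)
      show "AE p in ?MM. norm ((norm (P ** ?u p ** Q))\<^sup>2) \<le> ((1 + e) * ((1 + e) * (2 / (1 - r))))\<^sup>2"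
        using power_mono[OF conj_bound norm_ge_zero, of _ 2] by (intro AE_I2) auto
    qed measurable
    ultimately have "(\<integral>p. 3 / 4 * (norm (?u p))\<^sup>2 \<partial>?MM) \<le> (\<integral>p. (norm (P ** ?u p ** Q))\<^sup>2 \<partial>?MM)"
      using integrable_ratio_deviation(2) by (intro integral_mono) auto
    then show ?thesis
      by (simp add: ratio_spread_def)
  qed
  have "(\<integral>p. (norm ((P ** Q - mat 1) + P ** ?u p ** Q))\<^sup>2 \<partial>?MM) =
      (norm (P ** Q - mat 1))\<^sup>2 + 2 * ((P ** Q - mat 1) \<bullet> (\<integral>p. P ** ?u p ** Q \<partial>?MM)) +
      (\<integral>p. (norm (P ** ?u p ** Q))\<^sup>2 \<partial>?MM)"
  proof (rule MM.expectation_norm_power2_add)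
    show "norm (P ** ?u p ** Q) \<le> (1 + e) * ((1 + e) * (2 / (1 - r)))" if "p \<in> space ?MM" for p
      using that by (rule conj_bound)
  qed measurable
  also have "(\<lambda>p. (norm ((P ** Q - mat 1) + P ** ?u p ** Q))\<^sup>2) =
      (\<lambda>p. (norm (P ** ratio (Suc i) p ** Q - mat 1))\<^sup>2)"
    by (simp add: matrix_mult.diff_left matrix_mult.diff_right)
  finally show ?thesis
    using inner diffusion v by linarith
qed

text \<open>
  With \<open>P\<close> the product and \<open>P'\<close> its independent copy, \<open>(P n, matrix_inv (P' n))\<close> is a chain whose step
  inserts a ratio between its two components. Frozen when one component leaves the \<open>e\<close>-ball
  around the identity, the product of the components has bounded distance from the identity,
  whereas each step adds at least half of \<open>ratio_spread\<close> times the probability that the chain is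
  still moving. This probability is at least \<open>1 / 4\<close>, since each of the two copies stays near the
  identity with probability at least \<open>1 / 2\<close>.
\<close>

lemma dispersions_summable_if_product_stays:
  assumes e: "0 < e" "50 * ((1 + r) / (1 - r)) * e \<le> 1"
    and stays: "prob {\<omega> \<in> space M. \<exists>n. e / 2 < norm (partial_prod n \<omega> - mat 1)} \<le> 1 / 2"
  shows "summable (\<lambda>j. dispersion (Suc j))"
proof -
  interpret MM: pair_prob_space M M ..
  let ?MM = "M \<Otimes>\<^sub>M M"
  have "50 * 1 * e \<le> 50 * ((1 + r) / (1 - r)) * e"
    using e(1) r_nonneg r_less_1 by (intro mult_right_mono mult_left_mono) (auto simp: field_simps)
  then have e_le: "e \<le> 1 / 50"
    using e(2) by linarith
  define \<xi> where "\<xi> i p = (y i (fst p), inverse_factor i (snd p))" for i p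
  define F :: "nat \<Rightarrow> (real ^ 'k ^ 'k) \<times> (real ^ 'k ^ 'k) \<Rightarrow> (real ^ 'k ^ 'k) \<times> (real ^ 'k ^ 'k) \<Rightarrow>
      (real ^ 'k ^ 'k) \<times> (real ^ 'k ^ 'k)"
    where "F n s x = (fst s ** fst x, snd x ** snd s)" for n s x
  define A :: "((real ^ 'k ^ 'k) \<times> (real ^ 'k ^ 'k)) set"
    where "A = {s. norm (fst s - mat 1) \<le> e \<and> norm (snd s - mat 1) \<le> e}"
  define \<Phi> :: "(real ^ 'k ^ 'k) \<times> (real ^ 'k ^ 'k) \<Rightarrow> real"
    where "\<Phi> s = (norm (fst s ** snd s - mat 1))\<^sup>2" for s
  define C where "C = (norm (mat 1 :: real ^ 'k ^ 'k) + 4 * (norm (mat 1 :: real ^ 'k ^ 'k) + 2 / (1 - r)))\<^sup>2"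
  have \<Phi>_F: "\<Phi> (F n s (\<xi> i p)) = (norm (fst s ** ratio i p ** snd s - mat 1))\<^sup>2" for n s i p
    by (simp add: \<Phi>_def F_def \<xi>_def ratio_def matrix_mul_assoc)
  have conj_bound: "(norm (fst s ** q ** snd s - mat 1))\<^sup>2 \<le> C"
    if s: "s \<in> A" and q: "norm (q - mat 1) \<le> 2 / (1 - r)" for s q
  proof -
    have "norm (fst s ** q ** snd s) \<le> (1 + e) * ((1 + e) * norm q)"
    proof -
      have P: "norm (fst s - mat 1) \<le> e" and Q: "norm (snd s - mat 1) \<le> e"
        using s by (auto simp: A_def)
      show ?thesis
        by (rule order_trans[OF near_identity_mult_right(1)[OF Q]
              mult_left_mono[OF near_identity_mult_left(1)[OF P]]]) (use e(1) in simp)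
    qed
    also have "\<dots> \<le> 2 * (2 * norm q)"
      using e(1) e_le by (intro mult_mono) auto
    also have "\<dots> \<le> 4 * (norm (mat 1 :: real ^ 'k ^ 'k) + 2 / (1 - r))"
      using norm_triangle_sub[of q "mat 1"] q by simp
    finally have "norm (fst s ** q ** snd s - mat 1) \<le>
        norm (mat 1 :: real ^ 'k ^ 'k) + 4 * (norm (mat 1 :: real ^ 'k ^ 'k) + 2 / (1 - r))"
      using norm_triangle_ineq4[of "fst s ** q ** snd s" "mat 1"] by linarith
    then show ?thesis
      unfolding C_def by (intro power_mono) auto
  qed
  have \<xi>_indep: "MM.indep_vars (\<lambda>_. borel \<Otimes>\<^sub>M borel) \<xi> {1..}"
  proof -
    define T :: "(real ^ 'k ^ 'k) \<times> (real ^ 'k ^ 'k) \<Rightarrow> (real ^ 'k ^ 'k) \<times> (real ^ 'k ^ 'k)"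
      where "T = (\<lambda>(a, b). (a, if b \<in> GL then matrix_inv b else mat 1))"
    have "(\<lambda>s. (fst s, if snd s \<in> GL then matrix_inv (snd s) else mat 1))
        \<in> borel \<Otimes>\<^sub>M borel \<rightarrow>\<^sub>M borel \<Otimes>\<^sub>M (borel :: (real ^ 'k ^ 'k) measure)"
      by (intro measurable_Pair measurable_fst
          measurable_compose[OF measurable_snd borel_measurable_matrix_inv_restrict])
    then have "T \<in> borel \<Otimes>\<^sub>M borel \<rightarrow>\<^sub>M borel \<Otimes>\<^sub>M borel"
      by (simp add: T_def case_prod_beta')
    with indep_vars_two_copies[OF indep]
    have "MM.indep_vars (\<lambda>_. borel \<Otimes>\<^sub>M borel) (\<lambda>i. T \<circ> (\<lambda>p. (y i (fst p), y i (snd p)))) {1..}"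
      by (rule MM.indep_vars_compose)
    then show ?thesis
      by (simp add: T_def comp_def \<xi>_def[abs_def] inverse_factor_def)
  qed
  interpret chain: stopped_chain ?MM \<xi> "borel \<Otimes>\<^sub>M borel" F A "(mat 1, mat 1)" \<Phi> C
  proof
    show "MM.indep_vars (\<lambda>_. borel \<Otimes>\<^sub>M borel) \<xi> {1..}"
      by (rule \<xi>_indep)
    show "(\<lambda>(s, x). F n s x) \<in> borel \<Otimes>\<^sub>M (borel \<Otimes>\<^sub>M borel) \<rightarrow>\<^sub>M borel" for n
    proof -
      have "(\<lambda>p. (fst (fst p) ** fst (snd p), snd (snd p) ** snd (fst p)))
          \<in> (borel \<Otimes>\<^sub>M borel) \<Otimes>\<^sub>M (borel \<Otimes>\<^sub>M borel) \<rightarrow>\<^sub>M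
            (borel :: (real ^ 'k ^ 'k) measure) \<Otimes>\<^sub>M (borel :: (real ^ 'k ^ 'k) measure)"
        by (intro measurable_Pair borel_measurable_matrix_mult
            measurable_compose[OF measurable_fst measurable_fst]
            measurable_compose[OF measurable_fst measurable_snd]
            measurable_compose[OF measurable_snd measurable_fst]
            measurable_compose[OF measurable_snd measurable_snd])
      then show ?thesis
        by (simp only: F_def case_prod_beta' borel_prod)
    qed
    show "A \<in> sets borel"
    proof -
      have "{s \<in> space (borel \<Otimes>\<^sub>M borel). norm (fst s - (mat 1 :: real ^ 'k ^ 'k)) \<le> e \<and>
          norm (snd s - (mat 1 :: real ^ 'k ^ 'k)) \<le> e} \<in> sets (borel \<Otimes>\<^sub>M borel)"
        by measurable
      then show ?thesis
        by (simp only: A_def borel_prod space_borel UNIV_I simp_thms)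
    qed
    show "\<Phi> \<in> borel_measurable borel"
    proof -
      have "(\<lambda>s. (norm (fst s ** snd s - (mat 1 :: real ^ 'k ^ 'k)))\<^sup>2)
          \<in> borel_measurable (borel \<Otimes>\<^sub>M (borel :: (real ^ 'k ^ 'k) measure))"
        by measurable
      then show ?thesis
        by (simp only: \<Phi>_def[abs_def] borel_prod)
    qed
    show "\<Phi> (F n s (\<xi> (Suc n) p)) \<le> C" if "s \<in> A" "p \<in> space ?MM" for n s p
      unfolding \<Phi>_F using that by (intro conj_bound ratio_deviation_bound) auto
    show "\<Phi> s \<le> C" if "s \<in> A" for s
      using conj_bound[OF that, of "mat 1"] r_less_1 by (simp add: \<Phi>_def)
  qed (use e in \<open>auto simp: \<Phi>_def A_def\<close>)
  let ?G = "{\<omega> \<in> space M. \<forall>n. norm (partial_prod n \<omega> - mat 1) \<le> e / 2}"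
  have G [measurable]: "?G \<in> events"
    by measurable
  have "?G = space M - {\<omega> \<in> space M. \<exists>n. e / 2 < norm (partial_prod n \<omega> - mat 1)}"
    unfolding not_less[symmetric] by blast
  then have "prob ?G = 1 - prob {\<omega> \<in> space M. \<exists>n. e / 2 < norm (partial_prod n \<omega> - mat 1)}"
    by (simp only:) (rule prob_compl, measurable)
  then have G_half: "1 / 2 \<le> prob ?G"
    using stays by simp
  have chain_eq: "chain F (mat 1, mat 1) (\<lambda>i. \<xi> i p) n =
      (partial_prod n (fst p), matrix_inv (partial_prod n (snd p)))" if "p \<in> space ?MM" for n p
  proof (induction n)
    case 0
    then show ?case by (simp add: matrix_inv_unique)
  next
    case (Suc n)
    have "snd p \<in> space M"
      using that by (auto simp: space_pair_measure)
    then have "partial_prod n (snd p) \<in> GL" "y (Suc n) (snd p) \<in> GL"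
      by (auto intro!: ordered_prod_in_GL y_in_GL)
    with Suc \<open>snd p \<in> space M\<close> show ?case
      by (simp add: F_def \<xi>_def inverse_factor_eq matrix_inv_matrix_mult)
  qed
  have stay: "1 / 4 \<le> MM.prob {p \<in> space ?MM. chain.state n p \<in> A}" for n
  proof -
    have "1 / 2 * (1 / 2) \<le> prob ?G * prob ?G"
      using G_half by (intro mult_mono) auto
    also have "\<dots> = MM.prob (?G \<times> ?G)"
      using emeasure_pair_measure_Times[OF G G] by (simp add: measure_def enn2real_mult)
    also have "\<dots> \<le> MM.prob {p \<in> space ?MM. chain.state n p \<in> A}"
    proof (rule MM.finite_measure_mono)
      show "?G \<times> ?G \<subseteq> {p \<in> space ?MM. chain.state n p \<in> A}"
      proof
        fix p assume p: "p \<in> ?G \<times> ?G"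
        then have sp: "p \<in> space ?MM"
          by (auto simp: space_pair_measure)
        have in_A: "chain F (mat 1, mat 1) (\<lambda>i. \<xi> i p) j \<in> A" for j
        proof -
          have 1: "norm (partial_prod j (fst p) - mat 1) \<le> e / 2"
            and 2: "norm (partial_prod j (snd p) - mat 1) \<le> e / 2"
            using p by auto
          have "norm (matrix_inv (partial_prod j (snd p)) - mat 1) \<le> (e / 2) / (1 - e / 2)"
            using e_le by (intro norm_matrix_inv_near_identity(2)[OF 2]) simp
          also have "\<dots> \<le> (e / 2) / (1 / 2)"
            using e(1) e_le by (intro divide_left_mono) auto
          finally show ?thesis
            using 1 e(1) by (simp add: chain_eq[OF sp] A_def)
        qed
        then show "p \<in> {p \<in> space ?MM. chain.state n p \<in> A}"
          using sp by (simp add: chain.state_def chain_stop_outside_eq)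
      qed
    qed measurable
    finally show ?thesis by simp
  qed
  have sum_le: "(\<Sum>j<n. ratio_spread (Suc j)) \<le> 8 * C" for n
  proof -
    have "\<Phi> (mat 1, mat 1) + (\<Sum>j<n. ratio_spread (Suc j) / 2 * MM.prob {p \<in> space ?MM. chain.state j p \<in> A})
        \<le> MM.expectation (\<lambda>p. \<Phi> (chain.state n p))"
    proof (rule chain.expectation_state_ge)
      show "\<Phi> s + ratio_spread (Suc n) / 2 \<le> MM.expectation (\<lambda>p. \<Phi> (F n s (\<xi> (Suc n) p)))"
        if "s \<in> A" for n s
        using that e unfolding \<Phi>_F unfolding \<Phi>_def A_def
        by (intro expectation_conjugated_ratio_ge) auto
    qed
    also have "\<dots> \<le> MM.expectation (\<lambda>p. C)"
      by (intro integral_mono) (auto simp: chain.\<Phi>_state_bound)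
    finally have "(\<Sum>j<n. ratio_spread (Suc j) / 2 * MM.prob {p \<in> space ?MM. chain.state j p \<in> A}) \<le> C"
      by (simp add: \<Phi>_def MM.prob_space)
    moreover have "(\<Sum>j<n. ratio_spread (Suc j) / 2 * (1 / 4)) \<le>
        (\<Sum>j<n. ratio_spread (Suc j) / 2 * MM.prob {p \<in> space ?MM. chain.state j p \<in> A})"
      by (intro sum_mono mult_left_mono stay) (simp add: ratio_spread_def)
    ultimately show ?thesis
      by (simp add: sum_divide_distrib[symmetric])
  qed
  have "summable (\<lambda>j. ratio_spread (Suc j))"
    by (rule summableI_nonneg_bounded[OF _ sum_le]) (simp add: ratio_spread_def)
  then have "summable (\<lambda>j. 4 * ratio_spread (Suc j))"
    by (rule summable_mult)
  then show ?thesis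
    by (rule summable_comparison_test') (simp add: dispersion_le_ratio_spread dispersion_nonneg)
qed

text \<open>
  Almost sure convergence makes the products after a late time \<open>m\<close> stay near the identity with
  probability more than \<open>1 / 2\<close>.
\<close>

theorem dispersions_summable_if_product_converges:
  assumes conv: "AE \<omega> in M. converges_in_GL (\<lambda>n. partial_prod n \<omega>)"
  shows "summable (\<lambda>j. dispersion (Suc j))"
proof -
  define e where "e = 1 / (50 * ((1 + r) / (1 - r)))"
  have e: "0 < e" "50 * ((1 + r) / (1 - r)) * e \<le> 1"
    using r_nonneg r_less_1 by (auto simp: e_def)
  have "\<forall>\<^sub>F m in sequentially. prob {\<omega> \<in> space M. \<exists>n.
      e / 2 < norm (ordered_prod (\<lambda>i. y (m + i) \<omega>) n - mat 1)} < 1 / 2"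
    using e by (intro order_tendstoD(2)[OF prob_tail_leaves_tendsto_0[OF conv]]) auto
  then obtain m where m: "prob {\<omega> \<in> space M. \<exists>n.
      e / 2 < norm (ordered_prod (\<lambda>i. y (m + i) \<omega>) n - mat 1)} < 1 / 2"
    by (auto simp: eventually_sequentially)
  interpret shifted: near_identity_factors M "\<lambda>i. y (m + i)" r
    by (rule shift)
  have "summable (\<lambda>j. dispersion (m + Suc j))"
    using m by (intro shifted.dispersions_summable_if_product_stays[OF e]) simp
  moreover have "m + Suc j = Suc (j + m)" for j
    by simp
  ultimately have "summable (\<lambda>j. dispersion (Suc (j + m)))"
    by (simp only:)
  then show ?thesis
    by (simp only: summable_iff_shift[of "\<lambda>j. dispersion (Suc j)" m])
qed

end

section \<open>Truncation\<close>

text \<open>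
  The contrapositive of the second Borel--Cantelli lemma. For some \<open>m\<close> all events after time \<open>m\<close> occur
  together with probability at least \<open>1 / 2\<close>; by independence and \<open>p \<le> exp (- (1 - p))\<close> this bounds the
  partial sums of the complementary probabilities by \<open>ln 2\<close>.
\<close>

lemma (in prob_space) summable_prob_compl_if_AE_eventually:
  assumes indep: "indep_events C {1..}"
    and ae: "AE \<omega> in M. \<forall>\<^sub>F n in sequentially. \<omega> \<in> C n"
  shows "summable (\<lambda>n. 1 - prob (C (Suc n)))"
proof -
  have C [measurable]: "C (Suc n) \<in> events" for n
    using indep by (auto simp: indep_events_def)
  have "(\<lambda>m. prob {\<omega> \<in> space M. \<exists>n. \<omega> \<notin> C (Suc (n + m))}) \<longlonglongrightarrow> 0"
  proof (rule prob_tendsto_0_if_AE_eventually_not)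
    show "AE \<omega> in M. \<forall>\<^sub>F m in sequentially. \<not> (\<exists>n. \<omega> \<notin> C (Suc (n + m)))"
      using ae
    proof eventually_elim
      case (elim \<omega>)
      from eventually_all_ge_at_top[OF this] show ?case
        by eventually_elim auto
    qed
  qed measurable
  then have "\<forall>\<^sub>F m in sequentially. prob {\<omega> \<in> space M. \<exists>n. \<omega> \<notin> C (Suc (n + m))} < 1 / 2"
    by (rule order_tendstoD) simp
  then obtain m where m: "prob {\<omega> \<in> space M. \<exists>n. \<omega> \<notin> C (Suc (n + m))} < 1 / 2"
    by (auto simp: eventually_sequentially)
  have "(\<Sum>j<N. 1 - prob (C (Suc (j + m)))) \<le> ln 2" for N
  proof (cases "N = 0")
    case False
    let ?J = "(\<lambda>j. Suc (j + m)) ` {..<N}"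
    have "(\<Inter>i\<in>?J. C i) \<in> events"
      using False by (intro sets.finite_INT) auto
    then have compl: "prob (space M - (\<Inter>i\<in>?J. C i)) = 1 - prob (\<Inter>i\<in>?J. C i)"
      by (rule prob_compl)
    have "prob (space M - (\<Inter>i\<in>?J. C i)) \<le> prob {\<omega> \<in> space M. \<exists>n. \<omega> \<notin> C (Suc (n + m))}"
      by (intro finite_measure_mono) (auto, measurable)
    with m compl have "1 / 2 \<le> prob (\<Inter>i\<in>?J. C i)"
      by linarith
    also have "prob (\<Inter>i\<in>?J. C i) = (\<Prod>i\<in>?J. prob (C i))"
    proof -
      have "?J \<subseteq> {1..}" "?J \<noteq> {}" "finite ?J"
        using False by auto
      then show ?thesis
        using indep unfolding indep_events_def by blast
    qed
    also have "\<dots> = (\<Prod>j<N. prob (C (Suc (j + m))))"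
      by (subst prod.reindex) (auto simp: inj_on_def)
    also have "\<dots> \<le> (\<Prod>j<N. exp (- (1 - prob (C (Suc (j + m))))))"
    proof (intro prod_mono conjI)
      show "prob (C (Suc (j + m))) \<le> exp (- (1 - prob (C (Suc (j + m)))))" for j
        using exp_ge_add_one_self[of "- (1 - prob (C (Suc (j + m))))"] by simp
    qed simp
    also have "\<dots> = exp (- (\<Sum>j<N. 1 - prob (C (Suc (j + m)))))"
      by (simp only: exp_sum[symmetric] finite_lessThan sum_negf)
    finally have "ln (1 / 2) \<le> - (\<Sum>j<N. 1 - prob (C (Suc (j + m))))"
      by (subst (asm) ln_le_cancel_iff[symmetric]) simp_all
    then show ?thesis
      by (simp add: ln_div)
  qed simp
  then have "summable (\<lambda>j. 1 - prob (C (Suc (j + m))))"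
    by (intro summableI_nonneg_bounded) auto
  then show ?thesis
    by (simp only: summable_iff_shift[of "\<lambda>j. 1 - prob (C (Suc j))" m])
qed

text \<open>
  A limit that holds almost everywhere can be replaced by a measurable function with values in the
  group everywhere, by using the identity matrix where the limit does not exist in the group.
\<close>

lemma ex_measurable_limit_in_GL_iff:
  assumes s [measurable]: "\<And>n. s n \<in> borel_measurable M"
  shows "(\<exists>X \<in> M \<rightarrow>\<^sub>M restrict_space borel GL. AE \<omega> in M. (\<lambda>n. s n \<omega>) \<longlonglongrightarrow> X \<omega>) \<longleftrightarrow>
    (AE \<omega> in M. converges_in_GL (\<lambda>n. s n \<omega>))" (is "?L \<longleftrightarrow> ?R")
proof
  assume ?L
  then obtain X where X: "X \<in> M \<rightarrow>\<^sub>M restrict_space borel GL" "AE \<omega> in M. (\<lambda>n. s n \<omega>) \<longlonglongrightarrow> X \<omega>"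
    by blast
  from X(2) AE_space show ?R
  proof eventually_elim
    case (elim \<omega>)
    then have "X \<omega> \<in> GL"
      using measurable_space[OF X(1)] by (auto simp: space_restrict_space)
    with elim show ?case
      by (auto simp: converges_in_GL_def)
  qed
next
  assume R: ?R
  let ?l = "\<lambda>\<omega>. lim (\<lambda>n. s n \<omega>)"
  let ?X = "\<lambda>\<omega>. if ?l \<omega> \<in> GL then ?l \<omega> else mat 1"
  have [measurable]: "?l \<in> borel_measurable M"
    by measurable
  have "?X \<in> borel_measurable M"
    by measurable
  then have "?X \<in> M \<rightarrow>\<^sub>M restrict_space borel GL"
    by (intro measurable_restrict_space2) auto
  moreover from R have "AE \<omega> in M. (\<lambda>n. s n \<omega>) \<longlonglongrightarrow> ?X \<omega>"
  proof eventually_elim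
    case (elim \<omega>)
    then show ?case
      by (auto simp: converges_in_GL_def limI)
  qed
  ultimately show ?L by (intro bexI[where x = ?X])
qed

theorem theorem2:
  fixes M :: "'a measure" and x :: "nat \<Rightarrow> 'a \<Rightarrow> real ^ 'k ^ 'k" and r :: real
    and b :: "nat \<Rightarrow> real ^ 'k ^ 'k"
  assumes "prob_space M"
    and "\<And>n. n \<ge> 1 \<Longrightarrow> x n \<in> M \<rightarrow>\<^sub>M restrict_space borel GL"
    and "prob_space.indep_vars M (\<lambda>_. restrict_space borel GL) x {1..}"
    and "0 < r" and "r < 1"
    and "\<And>n. n \<ge> 1 \<Longrightarrow> b n = truncated_mean M r (x n)"
  shows "(\<exists>X \<in> M \<rightarrow>\<^sub>M restrict_space borel GL.
            AE \<omega> in M. (\<lambda>n. ordered_prod (\<lambda>i. x i \<omega>) n) \<longlonglongrightarrow> X \<omega>)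
     \<longleftrightarrow>
         (summable (\<lambda>n. measure M {\<omega> \<in> space M. norm (x (Suc n) \<omega> - mat 1) > r})
        \<and> converges_in_GL (ordered_prod b)
        \<and> summable (\<lambda>n. \<integral>\<omega>. (norm (x (Suc n) \<omega> - b (Suc n)))\<^sup>2 *
              indicator {\<omega> \<in> space M. norm (x (Suc n) \<omega> - mat 1) \<le> r} \<omega> \<partial>M))"
proof -
  interpret prob_space M by fact
  have x_GL: "x i \<omega> \<in> GL" if "1 \<le> i" "\<omega> \<in> space M" for i \<omega>
    using measurable_space[OF assms(2)[OF that(1)] that(2)] by (auto simp: space_restrict_space)
  have x_measurable: "x i \<in> borel_measurable M" if "1 \<le> i" for i
    using assms(2)[OF that] by (simp add: measurable_restrict_space2_iff)
  have x_Suc [measurable]: "x (Suc i) \<in> borel_measurable M" for i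
    by (rule x_measurable) simp
  define T :: "real ^ 'k ^ 'k \<Rightarrow> real ^ 'k ^ 'k"
    where "T A = (if norm (A - mat 1) \<le> r then A else mat 1)" for A
  define y where "y i \<omega> = T (x i \<omega>)" for i \<omega>
  have T_borel: "T \<in> borel_measurable borel"
    unfolding T_def[abs_def] by measurable
  have y_eq: "y i \<omega> = x i \<omega>" if "norm (x i \<omega> - mat 1) \<le> r" for i \<omega>
    using that by (simp add: y_def T_def)
  interpret near_identity_factors M y r
  proof
    show "indep_vars (\<lambda>_. borel) y {1..}"
      unfolding y_def using assms(3)
      by (rule indep_vars_compose2) (rule measurable_restrict_space1[OF T_borel])
    show "norm (y i \<omega> - mat 1) \<le> r" for i \<omega>
      using assms(4) by (simp add: y_def T_def)
  qed (rule assms(5))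
  let ?big = "\<lambda>i. {\<omega> \<in> space M. norm (x i \<omega> - mat 1) > r}"
  let ?small = "\<lambda>i. {\<omega> \<in> space M. norm (x i \<omega> - mat 1) \<le> r}"
  let ?m3 = "\<lambda>i \<omega>. (norm (x i \<omega> - b i))\<^sup>2 * indicator (?small i) \<omega>"
  have small_measurable [measurable]: "?small (Suc i) \<in> events" and big_measurable [measurable]: "?big (Suc i) \<in> events" for i
    by measurable
  have mean_eq: "mean i = b i" if i: "1 \<le> i" for i
  proof -
    have V: "indicator (?small i) \<omega> *\<^sub>R (x i \<omega> - mat 1) = y i \<omega> - mat 1" if "\<omega> \<in> space M" for \<omega>
      using that by (simp add: y_def T_def)
    have "b i = mat 1 + expectation (\<lambda>\<omega>. y i \<omega> - mat 1)"
      unfolding assms(6)[OF i] truncated_mean_def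
      by (intro arg_cong2[where f = "(+)"] refl Bochner_Integration.integral_cong V)
    also have "\<dots> = mean i"
      using y_integrable[OF i] by (simp add: prob_space)
    finally show ?thesis ..
  qed
  have prods_eq: "ordered_prod mean = ordered_prod b"
    by (intro ext ordered_prod_cong mean_eq)
  have m3_le: "?m3 (Suc n) \<omega> \<le> (norm (y (Suc n) \<omega> - mean (Suc n)))\<^sup>2" for n \<omega>
    by (simp add: mean_eq y_eq indicator_def)
  have m3_integrable: "integrable M (?m3 (Suc n))" for n
    by (rule Bochner_Integration.integrable_bound[OF integrable_deviation_power2[of n]])
       (measurable, use m3_le in \<open>simp add: abs_mult\<close>)
  have x_prod_measurable: "(\<lambda>\<omega>. ordered_prod (\<lambda>i. x i \<omega>) n) \<in> borel_measurable M" for n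
    by (induction n) auto
  note limit_iff = ex_measurable_limit_in_GL_iff[OF x_prod_measurable]
  show ?thesis
    unfolding limit_iff
  proof (intro iffI conjI)
    assume conv: "AE \<omega> in M. converges_in_GL (\<lambda>n. ordered_prod (\<lambda>i. x i \<omega>) n)"
    have ev: "AE \<omega> in M. \<forall>\<^sub>F i in sequentially. norm (x i \<omega> - mat 1) \<le> r"
      using conv AE_space
    proof eventually_elim
      case (elim \<omega>)
      then have "\<forall>\<^sub>F m in sequentially. \<forall>n. norm (ordered_prod (\<lambda>i. x (m + i) \<omega>) n - mat 1) \<le> r"
        using x_GL assms(4) by (intro converges_in_GL_ordered_prodD) auto
      then have "\<forall>\<^sub>F m in sequentially. norm (x (Suc m) \<omega> - mat 1) \<le> r"
        by (rule eventually_mono) (drule spec[of _ 1], simp)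
      then show ?case
        using eventually_sequentially_Suc[of "\<lambda>i. norm (x i \<omega> - mat 1) \<le> r"] by simp
    qed
    have "indep_events (\<lambda>i. ?small i) {1..}"
    proof (rule indep_eventsI_indep_vars[OF assms(3)])
      have [measurable]: "(\<lambda>A. A) \<in> restrict_space borel GL \<rightarrow>\<^sub>M (borel :: (real ^ 'k ^ 'k) measure)"
        by (rule measurable_restrict_space1) simp
      show "{A \<in> space (restrict_space borel GL). norm (A - (mat 1 :: real ^ 'k ^ 'k)) \<le> r}
          \<in> sets (restrict_space borel GL)"
        by measurable
    qed
    moreover have "AE \<omega> in M. \<forall>\<^sub>F i in sequentially. \<omega> \<in> ?small i"
      using ev AE_space by eventually_elim simp
    ultimately have "summable (\<lambda>n. 1 - prob (?small (Suc n)))"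
      by (rule summable_prob_compl_if_AE_eventually)
    moreover have "1 - prob (?small (Suc n)) = prob (?big (Suc n))" for n
    proof -
      have "?big (Suc n) = space M - ?small (Suc n)"
        by auto
      then show ?thesis
        by (simp only: prob_compl[OF small_measurable])
    qed
    ultimately show "summable (\<lambda>n. prob (?big (Suc n)))"
      by (simp only:)
    have y_conv: "AE \<omega> in M. converges_in_GL (\<lambda>n. partial_prod n \<omega>)"
      using conv ev AE_space
    proof eventually_elim
      case (elim \<omega>)
      from elim(2) have "\<forall>\<^sub>F i in sequentially. x i \<omega> = y i \<omega>"
        by eventually_elim (simp add: y_eq)
      then show ?case
        by (intro converges_in_GL_ordered_prod_transfer[OF elim(1)] x_GL y_in_GL elim(3))
    qed
    then have disp: "summable (\<lambda>n. dispersion (Suc n))"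
      by (rule dispersions_summable_if_product_converges)
    show "converges_in_GL (ordered_prod b)"
      using means_converge_if_product_converges[OF y_conv disp] by (simp only: prods_eq)
    show "summable (\<lambda>n. expectation (?m3 (Suc n)))"
    proof (rule summable_comparison_test'[OF disp])
      show "norm (expectation (?m3 (Suc n))) \<le> dispersion (Suc n)" for n
      proof -
        have "0 \<le> expectation (?m3 (Suc n))"
          by (rule integral_nonneg_AE) simp
        moreover have "expectation (?m3 (Suc n)) \<le> dispersion (Suc n)"
          by (intro integral_mono m3_integrable integrable_deviation_power2 m3_le)
        ultimately show ?thesis by simp
      qed
    qed
  next
    assume "summable (\<lambda>n. prob (?big (Suc n))) \<and> converges_in_GL (ordered_prod b) \<and>
      summable (\<lambda>n. expectation (?m3 (Suc n)))"
    then have M1: "summable (\<lambda>n. prob (?big (Suc n)))"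
      and M2: "converges_in_GL (ordered_prod mean)"
      and M3: "summable (\<lambda>n. expectation (?m3 (Suc n)))"
      by (simp_all only: prods_eq)
    \<comment> \<open>Where the factor was replaced, \<open>y = I\<close>, which is within \<open>r < 1\<close> of the mean.\<close>
    have disp_le: "dispersion (Suc n) \<le> expectation (?m3 (Suc n)) + prob (?big (Suc n))" for n
    proof -
      have big_int: "integrable M (indicator (?big (Suc n)) :: 'a \<Rightarrow> real)"
        by (intro integrable_real_indicator) (measurable, simp add: less_top[symmetric])
      have "dispersion (Suc n) \<le> expectation (\<lambda>\<omega>. ?m3 (Suc n) \<omega> + indicator (?big (Suc n)) \<omega>)"
      proof (rule integral_mono)
        fix \<omega> assume \<omega>: "\<omega> \<in> space M"
        show "(norm (y (Suc n) \<omega> - mean (Suc n)))\<^sup>2 \<le> ?m3 (Suc n) \<omega> + indicator (?big (Suc n)) \<omega>"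
        proof (cases "norm (x (Suc n) \<omega> - mat 1) \<le> r")
          case True
          then show ?thesis
            using \<omega> by (simp add: y_eq mean_eq)
        next
          case False
          have "norm (mat 1 - mean (Suc n)) \<le> 1"
            using mean_near[of "Suc n"] assms(5) by (simp add: norm_minus_commute)
          then have "(norm (mat 1 - mean (Suc n)))\<^sup>2 \<le> 1\<^sup>2"
            by (intro power_mono) auto
          then show ?thesis
            using False \<omega> by (simp add: y_def T_def)
        qed
      qed (intro Bochner_Integration.integrable_add m3_integrable big_int integrable_deviation_power2)+
      also have "\<dots> = expectation (?m3 (Suc n)) + prob (?big (Suc n))"
        using Bochner_Integration.integral_add[OF m3_integrable[of n] big_int] by simp
      finally show ?thesis .
    qed
    have "summable (\<lambda>n. dispersion (Suc n))"
      by (rule summable_comparison_test'[OF summable_add[OF M3 M1]])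
         (simp add: disp_le dispersion_nonneg)
    then have y_conv: "AE \<omega> in M. converges_in_GL (\<lambda>n. partial_prod n \<omega>)"
      by (rule product_converges_if_means_converge[OF M2])
    have "AE \<omega> in M. \<forall>\<^sub>F n in sequentially. \<omega> \<in> space M - ?big (Suc n)"
      by (rule borel_cantelli_AE1) (measurable, use M1 in \<open>auto simp: less_top[symmetric]\<close>)
    with y_conv AE_space show "AE \<omega> in M. converges_in_GL (\<lambda>n. ordered_prod (\<lambda>i. x i \<omega>) n)"
    proof eventually_elim
      case (elim \<omega>)
      from elim(3) have "\<forall>\<^sub>F n in sequentially. y (Suc n) \<omega> = x (Suc n) \<omega>"
        by eventually_elim (auto simp: y_eq not_less)
      then have "\<forall>\<^sub>F n in sequentially. y n \<omega> = x n \<omega>"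
        using eventually_sequentially_Suc[of "\<lambda>n. y n \<omega> = x n \<omega>"] by simp
      then show ?case
        by (intro converges_in_GL_ordered_prod_transfer[OF elim(1)] x_GL y_in_GL elim(2))
    qed
  qed
qed

end
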